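(* Let $(\ell_m)_{m\in\mathbf Z}$ be the sequence of segments of a billiard trajectory within the ellipse $\mathcal E$ in $\mathbf E^2$. Then each of the sets $$\mathrm P_k=\bigcup_{i-j=k}\ell_i\cap\ell_j,\qquad \mathrm Q_k=\bigcup_{i+j=k}\ell_i\cap\ell_j\qquad(k\in\mathbf Z)$$ belongs to a single conic confocal to $\mathcal E$. If the caustic of the trajectory $(\ell_m)$ is an ellipse, then the sets $\mathrm P_k$ are placed on ellipses and $\mathrm Q_k$ on hyperbolae. If the caustic is a hyperbola, then the sets $\mathrm P_k$, $\mathrm Q_k$ are placed on ellipses for $k$ even and on hyperbolae for $k$ odd.
   Context: A billiard trajectory within $\mathcal E$ is a polygonal line with vertices on $\mathcal E$ such that each pair of consecutive segments makes congruent angles with the normal to $\mathcal E$ at the common endpoint and lies on the same side of the tangent to $\mathcal E$ there. The trajectory is not assumed to be closed. All segments of a trajectory (or their extensions) are tangent to one and the same conic confocal with $\mathcal E$, called the caustic. The sequence $(\ell_m)$ lists consecutive segments in the order of motion, and $\ell_i\cap\ell_j$ is the intersection point of the lines containing the segments $\ell_i$ and $\ell_j$.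
   Formalization: For a hyperbolic caustic the parities for P_k are interchanged (ellipses for k odd, hyperbolae for k even), since P_1 consists of vertices on E; conics may also be limits of the confocal family (focal segment, axis, outer rays, lines through a circle's centre), except P_k for an elliptic caustic. *)

theory Defs
  imports "HOL-Analysis.Analysis"
begin

type_synonym plane = "real^2"

text \<open>
  Conics are given by their foci, so that two conics are confocal iff they have the same
  foci. In the set below \<open>s\<close> is the semi-major axis; it is a genuine ellipse if
  \<open>dist F1 F2 < 2 * s\<close>, and a circle if moreover \<open>F1 = F2\<close>. In the next one \<open>d\<close> is the
  transverse semi-axis; it is a genuine hyperbola (with both of its branches) if
  \<open>0 < d\<close> and \<open>2 * d < dist F1 F2\<close>.
\<close>

definition ellipse :: "plane \<Rightarrow> plane \<Rightarrow> real \<Rightarrow> plane set" where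
  "ellipse F1 F2 s = {X. dist X F1 + dist X F2 = 2 * s}"

definition hyperbola :: "plane \<Rightarrow> plane \<Rightarrow> real \<Rightarrow> plane set" where
  "hyperbola F1 F2 d = {X. \<bar>dist X F1 - dist X F2\<bar> = 2 * d}"

definition confocal_ellipse :: "plane \<Rightarrow> plane \<Rightarrow> plane set \<Rightarrow> bool" where
  "confocal_ellipse F1 F2 C \<longleftrightarrow> (\<exists>s. dist F1 F2 < 2 * s \<and> C = ellipse F1 F2 s)"

definition confocal_hyperbola :: "plane \<Rightarrow> plane \<Rightarrow> plane set \<Rightarrow> bool" where
  "confocal_hyperbola F1 F2 C \<longleftrightarrow> (\<exists>d. 0 < d \<and> 2 * d < dist F1 F2 \<and> C = hyperbola F1 F2 d)"

text \<open>
  The limiting members of the confocal family: ellipses flatten to the segment between the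
  foci; hyperbolae degenerate to the perpendicular bisector of the foci (\<open>d = 0\<close>) or to the
  two rays of the focal axis outside the foci (\<open>2 * d = dist F1 F2\<close>). When the foci
  coincide, confocal ellipses are concentric circles, there are no genuine confocal
  hyperbolae, and the lines through the centre are their only limits. Limiting members
  cannot be left out: for a trajectory that is symmetric about an axis of the ellipse,
  some of the sets of intersection points lie on that axis.
\<close>

definition limit_ellipse :: "plane \<Rightarrow> plane \<Rightarrow> plane set \<Rightarrow> bool" where
  "limit_ellipse F1 F2 C \<longleftrightarrow> C = closed_segment F1 F2"

definition limit_hyperbola :: "plane \<Rightarrow> plane \<Rightarrow> plane set \<Rightarrow> bool" where
  "limit_hyperbola F1 F2 C \<longleftrightarrow>
     (if F1 = F2 then \<exists>q. q \<noteq> F1 \<and> C = affine hull {F1, q}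
      else C = {X. dist X F1 = dist X F2} \<or> C = affine hull {F1, F2} - open_segment F1 F2)"

definition ellipse_or_limit :: "plane \<Rightarrow> plane \<Rightarrow> plane set \<Rightarrow> bool" where
  "ellipse_or_limit F1 F2 C \<longleftrightarrow> confocal_ellipse F1 F2 C \<or> limit_ellipse F1 F2 C"

definition hyperbola_or_limit :: "plane \<Rightarrow> plane \<Rightarrow> plane set \<Rightarrow> bool" where
  "hyperbola_or_limit F1 F2 C \<longleftrightarrow> confocal_hyperbola F1 F2 C \<or> limit_hyperbola F1 F2 C"

definition conic_or_limit :: "plane \<Rightarrow> plane \<Rightarrow> plane set \<Rightarrow> bool" where
  "conic_or_limit F1 F2 C \<longleftrightarrow> ellipse_or_limit F1 F2 C \<or> hyperbola_or_limit F1 F2 C"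

text \<open>
  Normal vectors are the gradients of the functions whose level sets are the conics;
  \<open>sgn x\<close> is the unit vector in the direction of \<open>x\<close>.
\<close>

definition ellipse_normal :: "plane \<Rightarrow> plane \<Rightarrow> plane \<Rightarrow> plane" where
  "ellipse_normal F1 F2 X = sgn (X - F1) + sgn (X - F2)"

definition hyperbola_normal :: "plane \<Rightarrow> plane \<Rightarrow> plane \<Rightarrow> plane" where
  "hyperbola_normal F1 F2 X = sgn (X - F1) - sgn (X - F2)"

lemma GDERIV_dist:
  fixes X F :: plane
  assumes "X \<noteq> F"
  shows "GDERIV (\<lambda>Y. dist Y F) X :> sgn (X - F)"
proof -
  have "((\<lambda>Y. norm (Y - F)) has_derivative (\<lambda>h. (h - 0) \<bullet> sgn (X - F))) (at X)"
    by (rule has_derivative_compose [where f = "\<lambda>Y. Y - F" and g = norm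
          and g' = "\<lambda>h. h \<bullet> sgn (X - F)"])
      (use assms GDERIV_norm [of "X - F"] in \<open>auto simp: gderiv_def intro!: derivative_eq_intros\<close>)
  then show ?thesis
    by (simp add: gderiv_def dist_norm)
qed

lemma GDERIV_ellipse_normal:
  assumes "X \<noteq> F1" "X \<noteq> F2"
  shows "GDERIV (\<lambda>Y. dist Y F1 + dist Y F2) X :> ellipse_normal F1 F2 X"
  unfolding ellipse_normal_def by (intro GDERIV_add GDERIV_dist assms)

lemma GDERIV_hyperbola_normal:
  assumes "X \<noteq> F1" "X \<noteq> F2"
  shows "GDERIV (\<lambda>Y. dist Y F1 - dist Y F2) X :> hyperbola_normal F1 F2 X"
  unfolding hyperbola_normal_def by (intro GDERIV_diff GDERIV_dist assms)

definition tangent_to_ellipse :: "plane \<Rightarrow> plane \<Rightarrow> real \<Rightarrow> plane set \<Rightarrow> bool" where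
  "tangent_to_ellipse F1 F2 s L \<longleftrightarrow>
     (\<exists>X\<in>ellipse F1 F2 s. L = {Y. (Y - X) \<bullet> ellipse_normal F1 F2 X = 0})"

text \<open>
  A line through the centre in direction \<open>u\<close> is an asymptote iff the cosine of its angle
  with the focal axis is, up to sign, \<open>2 * d / dist F1 F2\<close>. Asymptotes count as tangents
  (at a point at infinity), since a segment of a billiard trajectory can lie on an asymptote
  of its caustic.
\<close>

definition asymptote :: "plane \<Rightarrow> plane \<Rightarrow> real \<Rightarrow> plane set \<Rightarrow> bool" where
  "asymptote F1 F2 d L \<longleftrightarrow>
     (\<exists>u. u \<noteq> 0 \<and> \<bar>u \<bullet> (F2 - F1)\<bar> = 2 * d * norm u \<and>
          L = affine hull {midpoint F1 F2, midpoint F1 F2 + u})"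

definition tangent_to_hyperbola :: "plane \<Rightarrow> plane \<Rightarrow> real \<Rightarrow> plane set \<Rightarrow> bool" where
  "tangent_to_hyperbola F1 F2 d L \<longleftrightarrow>
     (\<exists>X\<in>hyperbola F1 F2 d. L = {Y. (Y - X) \<bullet> hyperbola_normal F1 F2 X = 0}) \<or>
     asymptote F1 F2 d L"

text \<open>
  The unit vector \<open>sgn w\<close> is the mirror image of \<open>sgn u\<close> in the line spanned by \<open>n\<close>: the
  vectors \<open>u\<close> and \<open>w\<close> make equal angles with \<open>n\<close>, lie on the same side of the line orthogonal
  to \<open>n\<close>, and lie on opposite sides of \<open>n\<close> itself (unless both are parallel to it).
\<close>

definition mirror_directions :: "plane \<Rightarrow> plane \<Rightarrow> plane \<Rightarrow> bool" where
  "mirror_directions n u w \<longleftrightarrow> sgn w = (2 * (sgn u \<bullet> sgn n)) *\<^sub>R sgn n - sgn u"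

definition billiard_trajectory :: "plane \<Rightarrow> plane \<Rightarrow> real \<Rightarrow> (int \<Rightarrow> plane) \<Rightarrow> bool" where
  "billiard_trajectory F1 F2 s v \<longleftrightarrow>
     (\<forall>m. v m \<in> ellipse F1 F2 s) \<and>
     (\<forall>m. v m \<noteq> v (m + 1)) \<and>
     (\<forall>m. mirror_directions (ellipse_normal F1 F2 (v m)) (v (m - 1) - v m) (v (m + 1) - v m))"

text \<open>The line containing the \<open>m\<close>-th segment, which joins \<open>v m\<close> to \<open>v (m + 1)\<close>.\<close>

definition side_line :: "(int \<Rightarrow> plane) \<Rightarrow> int \<Rightarrow> plane set" where
  "side_line v m = affine hull {v m, v (m + 1)}"

definition elliptic_caustic :: "plane \<Rightarrow> plane \<Rightarrow> (int \<Rightarrow> plane) \<Rightarrow> bool" where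
  "elliptic_caustic F1 F2 v \<longleftrightarrow>
     (\<exists>s. dist F1 F2 < 2 * s \<and> (\<forall>m. tangent_to_ellipse F1 F2 s (side_line v m)))"

definition hyperbolic_caustic :: "plane \<Rightarrow> plane \<Rightarrow> (int \<Rightarrow> plane) \<Rightarrow> bool" where
  "hyperbolic_caustic F1 F2 v \<longleftrightarrow>
     (\<exists>d. 0 < d \<and> 2 * d < dist F1 F2 \<and> (\<forall>m. tangent_to_hyperbola F1 F2 d (side_line v m)))"

text \<open>Coincident lines have no intersection point and contribute nothing; neither do parallels.\<close>

definition crossing :: "plane set \<Rightarrow> plane set \<Rightarrow> plane set" where
  "crossing L M = {p. L \<inter> M = {p}}"

definition P_set :: "(int \<Rightarrow> plane) \<Rightarrow> int \<Rightarrow> plane set" where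
  "P_set v k = (\<Union>(i, j)\<in>{(i, j). i - j = k}. crossing (side_line v i) (side_line v j))"

definition Q_set :: "(int \<Rightarrow> plane) \<Rightarrow> int \<Rightarrow> plane set" where
  "Q_set v k = (\<Union>(i, j)\<in>{(i, j). i + j = k}. crossing (side_line v i) (side_line v j))"

end

theory Submission
  imports Defs
begin

text \<open>
  In coordinates along the axes, with foci \<open>(\<plusminus>c, 0)\<close>, the oriented lines \<open>p x + q y = r\<close>,
  \<open>p\<^sup>2 + q\<^sup>2 = 1\<close>, that are tangent to the caustic form the curve \<open>r\<^sup>2 = A - c\<^sup>2 q\<^sup>2\<close>. It is
  parametrised by Jacobi functions, \<open>(p, q, r) = (cn u, sn u, \<surd>A dn u)\<close> with modulus
  \<open>k\<^sup>2 = c\<^sup>2 / A\<close>, whatever the type of the caustic: it is an ellipse for \<open>k < 1\<close>, a hyperbola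
  for \<open>k > 1\<close>, and degenerates to the pair of foci for \<open>k = 1\<close>. Joachimsthal's integral makes
  every reflection the translation of \<open>u\<close> by one and the same constant.

  The conics of the confocal family through the intersection point of two oriented tangents bisect
  the angles between them. Hence their parameters are functions of the difference \<open>u - u'\<close>
  for the one conic, and of the difference after reversing one line for the other. Such a reversal
  turns \<open>u'\<close> into \<open>-u'\<close> up to a half period, so the second parameter depends on \<open>u + u'\<close>. Orienting
  all lines by the motion, \<open>i - j\<close> determines the first parameter and \<open>i + j\<close> the second. The type
  of the conic follows from the sign of \<open>r\<close>, which is constant for an elliptic caustic, or of
  \<open>p\<close>, which alternates for a hyperbolic one.
\<close>

section \<open>Translations of the curve of oriented tangents\<close>


text \<open>\<open>k\<close> is the square \<open>c^2\<close> of half the focal distance, not the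
  modulus of the Jacobi functions.\<close>

definition on_curve :: "real \<Rightarrow> real \<Rightarrow> real \<Rightarrow> real \<Rightarrow> real \<Rightarrow> bool" where
  "on_curve A k p q r \<longleftrightarrow> p^2 = 1 - q^2 \<and> r^2 = A - k * q^2"

text \<open>The addition theorem of the Jacobi functions, with \<open>(cn, sn / \<surd>A, dn) = (g, t, e)\<close> at the
  shift.\<close>

definition shifted :: "real \<Rightarrow> real \<Rightarrow> real \<Rightarrow> real \<Rightarrow> real \<Rightarrow> real \<Rightarrow> real \<Rightarrow> real \<Rightarrow> real \<Rightarrow> real \<Rightarrow> bool" where
  "shifted k g t e p q r p' q' r' \<longleftrightarrow> 1 - k * t^2 * q^2 \<noteq> 0 \<and>
     (1 - k * t^2 * q^2) * p' = p * g - q * r * t * e \<and>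
     (1 - k * t^2 * q^2) * q' = q * g * e + p * r * t \<and>
     (1 - k * t^2 * q^2) * r' = r * e - k * t * g * p * q"

text \<open>The values of \<open>cn\<close> and \<open>dn\<close> at the difference of the arguments of two points.\<close>

definition cn_diff :: "real \<Rightarrow> real \<Rightarrow> real \<Rightarrow> real \<Rightarrow> real \<Rightarrow> real \<Rightarrow> real \<Rightarrow> real \<Rightarrow> real" where
  "cn_diff A k p q r p' q' r' = (A * p * p' + q * q' * r * r') / (A - k * q^2 * q'^2)"

definition dn_diff :: "real \<Rightarrow> real \<Rightarrow> real \<Rightarrow> real \<Rightarrow> real \<Rightarrow> real \<Rightarrow> real \<Rightarrow> real \<Rightarrow> real" where
  "dn_diff A k p q r p' q' r' = (r * r' + k * p * p' * q * q') / (A - k * q^2 * q'^2)"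

text \<open>Invariance of \<open>cn_diff\<close> under a common shift of both points, with every
  denominator cleared. This leaves a polynomial identity modulo the curve equations of the two
  points and the relations between \<open>g\<close>, \<open>t\<close>, \<open>e\<close>.\<close>

lemma cn_diff_identity:
  fixes A k g t e p1 q1 r1 p2 q2 r2 :: real
  assumes "p1^2 = 1 - q1^2" "r1^2 = A - k * q1^2" "p2^2 = 1 - q2^2" "r2^2 = A - k * q2^2"
    and "g^2 = 1 - A * t^2" "e^2 = 1 - k * t^2"
  shows "(A * (p1*g - q1*r1*t*e) * (p2*g - q2*r2*t*e) * (1 - k*t^2*q1^2) * (1 - k*t^2*q2^2)
       + (q1*g*e + p1*r1*t) * (q2*g*e + p2*r2*t) * (r1*e - k*t*g*p1*q1) * (r2*e - k*t*g*p2*q2))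
         * (A - k*q1^2*q2^2)
     = (A*p1*p2 + q1*q2*r1*r2) *
       (A * (1 - k*t^2*q1^2)^2 * (1 - k*t^2*q2^2)^2 - k * (q1*g*e + p1*r1*t)^2 * (q2*g*e + p2*r2*t)^2)"
  using assms by algebra

lemma dn_diff_identity:
  fixes A k g t e p1 q1 r1 p2 q2 r2 :: real
  assumes "p1^2 = 1 - q1^2" "r1^2 = A - k * q1^2" "p2^2 = 1 - q2^2" "r2^2 = A - k * q2^2"
    and "g^2 = 1 - A * t^2" "e^2 = 1 - k * t^2"
  shows "((r1*e - k*t*g*p1*q1) * (r2*e - k*t*g*p2*q2) * (1 - k*t^2*q1^2) * (1 - k*t^2*q2^2)
       + k * (p1*g - q1*r1*t*e) * (p2*g - q2*r2*t*e) * (q1*g*e + p1*r1*t) * (q2*g*e + p2*r2*t))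
         * (A - k*q1^2*q2^2)
     = (r1*r2 + k*p1*p2*q1*q2) *
       (A * (1 - k*t^2*q1^2)^2 * (1 - k*t^2*q2^2)^2 - k * (q1*g*e + p1*r1*t)^2 * (q2*g*e + p2*r2*t)^2)"
  using assms by algebra

text \<open>The inverse shift has \<open>- t\<close> in place of \<open>t\<close>, with the same
  \<open>g\<close> and \<open>e\<close>, since sn is odd while cn and dn are even.\<close>

lemma shift_back_identities:
  fixes A k g t e p q r p' q' r' :: real
  assumes "p^2 = 1 - q^2" "r^2 = A - k * q^2"
    and "g^2 = 1 - A * t^2" "e^2 = 1 - k * t^2"
  defines "N \<equiv> 1 - k*t^2*q^2" and "P \<equiv> p*g - q*r*t*e" and "Q \<equiv> q*g*e + p*r*t" and "R \<equiv> r*e - k*t*g*p*q"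
  shows "(N^2 - k*t^2*Q^2) * p = P*N*g + Q*R*t*e"
    "(N^2 - k*t^2*Q^2) * q = Q*N*g*e - P*R*t"
    "(N^2 - k*t^2*Q^2) * r = R*N*e + k*t*g*P*Q"
  unfolding N_def P_def Q_def R_def using assms(1-4) by algebra+

text \<open>With \<open>n\<close> the normal \<open>(x / a2, y / b2)\<close> at a vertex of the trajectory, \<open>J\<close> and \<open>K\<close> are the
  components of the incoming direction along and across \<open>n\<close>. Reflection changes the sign of the
  former, and \<open>(P, Q, R)\<close>, \<open>(P', Q', R')\<close> are the incoming and outgoing line multiplied by
  \<open>n\<^sup>2 = h\<close>.\<close>

lemma vertex_identities:
  fixes n1 n2 J K k a2 b2 h :: real
  assumes "a2 = b2 + k" "a2 * n1^2 + b2 * n2^2 = 1" "h = n1^2 + n2^2" "h = J^2 + K^2"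
  defines "P \<equiv> - (J*n2 + K*n1)" and "Q \<equiv> J*n1 - K*n2" and "R \<equiv> - (J*k*n1*n2 + K)"
   and "P' \<equiv> J*n2 - K*n1" and "Q' \<equiv> - (J*n1 + K*n2)" and "R' \<equiv> J*k*n1*n2 - K"
   and "w \<equiv> 1 + k*J^2"
  shows
   "R^2 = a2*(1 - b2*J^2) * h^2 - k * Q^2"
   "(w^2*h^2 - 4*k*J^2*Q^2) * P' = P*h^2*(1 - (a2+b2)*J^2)*w + 2*J*(1-k*J^2)*Q*R*h"
   "(w^2*h^2 - 4*k*J^2*Q^2) * Q' = Q*h^2*(1 - (a2+b2)*J^2)*(1-k*J^2) - 2*J*w*P*R*h"
   "(w^2*h^2 - 4*k*J^2*Q^2) * R' = R*h^2*w*(1-k*J^2) + 2*k*J*(1 - (a2+b2)*J^2)*P*Q*h"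
  unfolding P_def Q_def R_def P'_def Q'_def R'_def w_def using assms(1-4) by algebra+


section \<open>Invariance of the parameter difference under a common shift\<close>

lemma curve_nonneg:
  fixes A k :: real
  assumes "on_curve A k p q r" "0 \<le> k"
  shows "q^2 \<le> 1" "k * q^2 \<le> A" "0 \<le> A"
proof -
  have "0 \<le> p^2" "0 \<le> r^2" "0 \<le> q^2" by simp_all
  with assms show "q^2 \<le> 1" "k * q^2 \<le> A" by (auto simp: on_curve_def)
  with assms \<open>0 \<le> q^2\<close> show "0 \<le> A" by (meson mult_nonneg_nonneg order_trans)
qed

text \<open>Since \<open>k * q^2 \<le> A\<close> and \<open>q'^2 \<le> 1\<close>, the denominator
  can vanish only if both are equalities. The second point then gives \<open>k \<le> A\<close>,
  while \<open>A = k * q^2 \<le> k\<close>, which leads to the excluded case.\<close>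

lemma diff_denominator_pos:
  fixes A k :: real
  assumes c: "on_curve A k p q r" and c': "on_curve A k p' q' r'"
    and "0 \<le> k" "A \<noteq> 0" and nondeg: "\<not> (A = k \<and> q^2 = 1)"
  shows "0 < A - k * q^2 * q'^2"
proof -
  note 1 = curve_nonneg[OF c \<open>0 \<le> k\<close>] and 2 = curve_nonneg[OF c' \<open>0 \<le> k\<close>]
  have A: "0 < A" using 1 \<open>A \<noteq> 0\<close> by simp
  have le: "k * q^2 * q'^2 \<le> k * q^2" using 2 \<open>0 \<le> k\<close>
    by (intro mult_left_le) auto
  show ?thesis
  proof (cases "k * q^2 < A")
    case False
    then have eq: "k * q^2 = A" using 1 by simp
    then have "k \<noteq> 0" using A by auto
    have "q'^2 < 1"
    proof (rule ccontr)
      assume "\<not> q'^2 < 1"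
      then have "q'^2 = 1" using 2 by simp
      then have "k \<le> A" using 2 by simp
      moreover have "k * q^2 \<le> k" using 1 \<open>0 \<le> k\<close> by (simp add: mult_left_le)
      ultimately have "A = k" using eq by simp
      then have "q^2 = 1" using eq \<open>k \<noteq> 0\<close> by simp
      then show False using nondeg \<open>A = k\<close> by simp
    qed
    then show ?thesis using eq A by simp
  qed (use le in simp)
qed

text \<open>Both parameters grow by the same constant, so cn and dn of their difference do not
  change.\<close>

lemma diff_translate:
  fixes A k g t e :: real
  assumes c1: "on_curve A k p1 q1 r1" and c2: "on_curve A k p2 q2 r2"
    and s1: "shifted k g t e p1 q1 r1 p1' q1' r1'" and s2: "shifted k g t e p2 q2 r2 p2' q2' r2'"
    and ge: "g^2 = 1 - A * t^2" "e^2 = 1 - k * t^2"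
    and den: "A - k * q1^2 * q2^2 \<noteq> 0" "A - k * q1'^2 * q2'^2 \<noteq> 0"
  shows "cn_diff A k p1' q1' r1' p2' q2' r2' = cn_diff A k p1 q1 r1 p2 q2 r2"
    and "dn_diff A k p1' q1' r1' p2' q2' r2' = dn_diff A k p1 q1 r1 p2 q2 r2"
proof -
  define N1 where "N1 = 1 - k * t^2 * q1^2"
  define N2 where "N2 = 1 - k * t^2 * q2^2"
  have N: "N1 \<noteq> 0" "N2 \<noteq> 0" using s1 s2 by (simp_all add: shifted_def N1_def N2_def)
  note eqs1 = s1[unfolded shifted_def, folded N1_def, THEN conjunct2]
  note eqs2 = s2[unfolded shifted_def, folded N2_def, THEN conjunct2]
  have curve: "p1^2 = 1 - q1^2" "r1^2 = A - k * q1^2" "p2^2 = 1 - q2^2" "r2^2 = A - k * q2^2"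
    using c1 c2 by (simp_all add: on_curve_def)
  have E: "p1*g - q1*r1*t*e = N1 * p1'" "q1*g*e + p1*r1*t = N1 * q1'" "r1*e - k*t*g*p1*q1 = N1 * r1'"
     "p2*g - q2*r2*t*e = N2 * p2'" "q2*g*e + p2*r2*t = N2 * q2'" "r2*e - k*t*g*p2*q2 = N2 * r2'"
    using eqs1 eqs2 by simp_all
  have "(N1*N2)^2 * ((A * p1' * p2' + q1' * q2' * r1' * r2') * (A - k * q1^2 * q2^2))
      = (N1*N2)^2 * ((A * p1 * p2 + q1 * q2 * r1 * r2) * (A - k * q1'^2 * q2'^2))"
    using cn_diff_identity[OF curve ge] unfolding N1_def[symmetric] N2_def[symmetric] E
    by (simp add: algebra_simps power2_eq_square)
  then show "cn_diff A k p1' q1' r1' p2' q2' r2' = cn_diff A k p1 q1 r1 p2 q2 r2"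
    using N den by (simp add: cn_diff_def frac_eq_eq)
  have "(N1*N2)^2 * ((r1' * r2' + k * p1' * p2' * q1' * q2') * (A - k * q1^2 * q2^2))
      = (N1*N2)^2 * ((r1 * r2 + k * p1 * p2 * q1 * q2) * (A - k * q1'^2 * q2'^2))"
    using dn_diff_identity[OF curve ge] unfolding N1_def[symmetric] N2_def[symmetric] E
    by (simp add: algebra_simps power2_eq_square)
  then show "dn_diff A k p1' q1' r1' p2' q2' r2' = dn_diff A k p1 q1 r1 p2 q2 r2"
    using N den by (simp add: dn_diff_def frac_eq_eq)
qed

text \<open>Reversing the orientation changes the sign of the linear terms of the shift formulas but
  not of the quadratic ones, which carry the factor \<open>t\<close>. This turns the inverse shift,
  by \<open>- t\<close>, into the shift by \<open>t\<close>.\<close>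

lemma shifted_reverse:
  fixes A k g t e :: real
  assumes c: "on_curve A k p q r" and s: "shifted k g t e p q r p' q' r'"
    and ge: "g^2 = 1 - A * t^2" "e^2 = 1 - k * t^2" and den: "1 - k * t^2 * q'^2 \<noteq> 0"
  shows "shifted k g t e (- p') (- q') (- r') (- p) (- q) (- r)"
proof -
  define N where "N = 1 - k * t^2 * q^2"
  have N: "N \<noteq> 0" using s by (simp add: shifted_def N_def)
  note eqs = s[unfolded shifted_def, folded N_def, THEN conjunct2]
  have curve: "p^2 = 1 - q^2" "r^2 = A - k * q^2" using c by (simp_all add: on_curve_def)
  have E: "p*g - q*r*t*e = N * p'" "q*g*e + p*r*t = N * q'" "r*e - k*t*g*p*q = N * r'"
    using eqs by simp_all
  note rev = shift_back_identities[OF curve ge, folded N_def, unfolded E]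
  have "N^2 * ((1 - k * t^2 * q'^2) * p) = N^2 * (p' * g + q' * r' * t * e)"
    "N^2 * ((1 - k * t^2 * q'^2) * q) = N^2 * (q' * g * e - p' * r' * t)"
    "N^2 * ((1 - k * t^2 * q'^2) * r) = N^2 * (r' * e + k * t * g * p' * q')"
    using rev by (simp_all add: algebra_simps power2_eq_square)
  then have "(1 - k * t^2 * q'^2) * p = p' * g + q' * r' * t * e"
    "(1 - k * t^2 * q'^2) * q = q' * g * e - p' * r' * t"
    "(1 - k * t^2 * q'^2) * r = r' * e + k * t * g * p' * q'"
    using N by simp_all
  then show ?thesis using den by (simp add: shifted_def algebra_simps)
qed

section \<open>The two confocal conics through the intersection point of two lines\<close>

text \<open>The square of the semi-axis on the focal line of the conic that is tangent, at the intersection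
  point, to the bisector with normal \<open>(p + p', q + q')\<close>: a line \<open>(p, q, r)\<close> is tangent to the conic
  \<open>x\<^sup>2 / \<alpha> + y\<^sup>2 / (\<alpha> - k) = 1\<close> iff \<open>r\<^sup>2 = \<alpha> p\<^sup>2 + (\<alpha> - k) q\<^sup>2\<close>.\<close>

definition axis2 :: "real \<Rightarrow> real \<Rightarrow> real \<Rightarrow> real \<Rightarrow> real \<Rightarrow> real \<Rightarrow> real \<Rightarrow> real \<Rightarrow> real" where
  "axis2 A k p q r p' q' r' = (A + k * q * q' + r * r') / (1 + p * p' + q * q')"

text \<open>The axis depends on the two lines only through cn and dn of the parameter difference.
  The first relation fixes \<alpha> unless \<open>c = -1\<close>; the second takes over
  there.\<close>

lemma axis2_diff:
  fixes A k :: real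
  assumes c: "on_curve A k p q r" and c': "on_curve A k p' q' r'"
    and den: "A - k * q^2 * q'^2 \<noteq> 0" and D: "1 + p * p' + q * q' \<noteq> 0"
  defines "\<alpha> \<equiv> axis2 A k p q r p' q' r'"
    and "c \<equiv> cn_diff A k p q r p' q' r'" and "d \<equiv> dn_diff A k p q r p' q' r'"
  shows "\<alpha> * (1 + c) = A * (1 + d)"
    and "(A - \<alpha>) * (c + d) = - (A - k) * (1 - c)"
proof -
  define N where "N = A - k * q^2 * q'^2"
  define \<Delta> where "\<Delta> = 1 + p * p' + q * q'"
  have nz: "N * \<Delta> \<noteq> 0" using den D by (simp add: N_def \<Delta>_def)
  have a: "\<alpha> * \<Delta> = A + k * q * q' + r * r'" using D by (simp add: \<alpha>_def axis2_def \<Delta>_def)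
  have cd: "c * N = A * p * p' + q * q' * r * r'" "d * N = r * r' + k * p * p' * q * q'"
    using den by (simp_all add: c_def d_def cn_diff_def dn_diff_def N_def)
  have curve: "p^2 = 1 - q^2" "r^2 = A - k * q^2" "p'^2 = 1 - q'^2" "r'^2 = A - k * q'^2"
    using c c' by (simp_all add: on_curve_def)
  have "(A + k*q*q' + r*r') * (N + (A*p*p' + q*q'*r*r')) = A * (N + (r*r' + k*p*p'*q*q')) * \<Delta>"
    unfolding N_def \<Delta>_def using curve by algebra
  then have "N * \<Delta> * (\<alpha> * (1 + c)) = N * \<Delta> * (A * (1 + d))"
    unfolding a[symmetric] cd[symmetric] by (simp add: algebra_simps)
  then show "\<alpha> * (1 + c) = A * (1 + d)" using nz by simp
  have "(A * \<Delta> - (A + k*q*q' + r*r')) * ((A*p*p' + q*q'*r*r') + (r*r' + k*p*p'*q*q'))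
      = - (A - k) * (N - (A*p*p' + q*q'*r*r')) * \<Delta>"
    unfolding N_def \<Delta>_def using curve by algebra
  then have "N * \<Delta> * ((A - \<alpha>) * (c + d)) = N * \<Delta> * (- (A - k) * (1 - c))"
    unfolding a[symmetric] cd[symmetric] by (simp add: algebra_simps)
  then show "(A - \<alpha>) * (c + d) = - (A - k) * (1 - c)" using nz by simp
qed

text \<open>If \<open>c = -1\<close>, the first relation forces \<open>d = -1\<close>, and the
  second becomes \<open>\<alpha> = k\<close>.\<close>

lemma axis2_determined:
  fixes A k c d \<alpha> \<beta> :: real
  assumes "\<alpha> * (1 + c) = A * (1 + d)" "(A - \<alpha>) * (c + d) = - (A - k) * (1 - c)"
    and "\<beta> * (1 + c) = A * (1 + d)" "(A - \<beta>) * (c + d) = - (A - k) * (1 - c)"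
    and "A \<noteq> 0"
  shows "\<alpha> = \<beta>"
proof (cases "1 + c = 0")
  case True
  then have "c = -1" "d = -1" using assms by auto
  then show ?thesis using assms by simp
next
  case False
  then show ?thesis using assms by (metis mult_right_cancel)
qed

text \<open>The last two equations are Vieta's formulas for the quadratic in the squared focal
  semi-axis of a confocal conic through \<open>(x, y)\<close>. Reversing the second line exchanges
  the two bisectors, and with them the two conics.\<close>

lemma crossing_axes:
  fixes A k x y :: real
  assumes c: "on_curve A k p q r" and c': "on_curve A k p' q' r'"
    and X: "p * x + q * y = r" "p' * x + q' * y = r'" and D: "p * q' \<noteq> p' * q"
  defines "\<alpha> \<equiv> axis2 A k p q r p' q' r'" and "\<beta> \<equiv> axis2 A k p q r (- p') (- q') (- r')"
  shows "1 + p * p' + q * q' > 0" "1 - p * p' - q * q' > 0"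
    and "\<alpha> + \<beta> = x^2 + y^2 + k" "\<alpha> * \<beta> = k * x^2"
proof -
  define \<Delta> where "\<Delta> = 1 + p * p' + q * q'"
  define \<Delta>' where "\<Delta>' = 1 - p * p' - q * q'"
  define E where "E = p * q' - p' * q"
  have curve: "p^2 = 1 - q^2" "r^2 = A - k * q^2" "p'^2 = 1 - q'^2" "r'^2 = A - k * q'^2"
    using c c' by (simp_all add: on_curve_def)
  \<comment> \<open>The normals are unit vectors, so this is \<open>1 - cos^2 = sin^2\<close> for
    the angle between them.\<close>
  have prod: "\<Delta> * \<Delta>' = E^2" using curve unfolding \<Delta>_def \<Delta>'_def E_def by algebra
  have E: "E \<noteq> 0" using D by (simp add: E_def)
  have sum: "\<Delta> + \<Delta>' = 2" by (simp add: \<Delta>_def \<Delta>'_def)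
  have pos: "0 < \<Delta> * \<Delta>'" using prod E by simp
  have "\<Delta> > 0" "\<Delta>' > 0" using pos sum by (auto simp: zero_less_mult_iff)
  then show "1 + p * p' + q * q' > 0" "1 - p * p' - q * q' > 0" by (simp_all add: \<Delta>_def \<Delta>'_def)
  have a: "\<alpha> * \<Delta> = A + k * q * q' + r * r'" "\<beta> * \<Delta>' = A - k * q * q' - r * r'"
    using \<open>\<Delta> > 0\<close> \<open>\<Delta>' > 0\<close> by (simp_all add: \<alpha>_def \<beta>_def axis2_def \<Delta>_def \<Delta>'_def)
  \<comment> \<open>Cramer's rule for the intersection point.\<close>
  have xy: "x * E = r * q' - r' * q" "y * E = p * r' - p' * r"
    unfolding X[symmetric] E_def by algebra+
  have "(A + k*q*q' + r*r') * \<Delta>' + (A - k*q*q' - r*r') * \<Delta>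
      = (r*q' - r'*q)^2 + (p*r' - p'*r)^2 + k * E^2"
    unfolding \<Delta>_def \<Delta>'_def E_def using curve by algebra
  then have "(\<Delta> * \<Delta>') * (\<alpha> + \<beta>) = E^2 * (x^2 + y^2 + k)"
    unfolding a[symmetric] xy[symmetric] by (simp add: algebra_simps power2_eq_square)
  then show "\<alpha> + \<beta> = x^2 + y^2 + k" using E by (simp add: prod)
  have "(A + k*q*q' + r*r') * (A - k*q*q' - r*r') = k * (r*q' - r'*q)^2"
    using curve by algebra
  then have "(\<Delta> * \<Delta>') * (\<alpha> * \<beta>) = E^2 * (k * x^2)"
    unfolding a[symmetric] xy[symmetric] by (simp add: algebra_simps power2_eq_square)
  then show "\<alpha> * \<beta> = k * x^2" using E by (simp add: prod)
qed

text \<open>With the positive denominator cleared, this is the Cauchy-Schwarz inequality for the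
  form \<open>A * x^2 + (A - k) * y^2\<close>, which is positive definite for \<open>k < A\<close>
  and takes the values \<open>r^2\<close> and \<open>r'^2\<close> at the two normals.\<close>

lemma axis2_ge:
  fixes A k :: real
  assumes c: "on_curve A k p q r" and c': "on_curve A k p' q' r'"
    and "k < A" "0 \<le> k" "0 < r * r'" and D: "0 < 1 + p * p' + q * q'"
  shows "A \<le> axis2 A k p q r p' q' r'"
proof -
  have curve: "p^2 = 1 - q^2" "r^2 = A - k * q^2" "p'^2 = 1 - q'^2" "r'^2 = A - k * q'^2"
    using c c' by (simp_all add: on_curve_def)
  have eq: "(r * r')^2 - (A*p*p' + (A - k)*q*q')^2 = A * (A - k) * (p*q' - p'*q)^2"
    using curve by algebra
  have "0 \<le> A * (A - k) * (p*q' - p'*q)^2"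
    using \<open>k < A\<close> \<open>0 \<le> k\<close> by simp
  then have "(A*p*p' + (A - k)*q*q')^2 \<le> (r * r')^2"
    using eq by linarith
  then have "A*p*p' + (A - k)*q*q' \<le> r * r'"
    by (rule power2_le_imp_le) (use \<open>0 < r * r'\<close> in simp)
  then show ?thesis
    using D by (simp add: axis2_def pos_le_divide_eq algebra_simps)
qed

text \<open>Again Cauchy-Schwarz, now for the form \<open>x^2 + (k - A) * y^2\<close> at
  \<open>(r, q)\<close> and \<open>(r', q')\<close>, where the curve equations give it the values
  \<open>A * p^2\<close> and \<open>A * p'^2\<close>.\<close>

lemma axis2_le:
  fixes A k :: real
  assumes c: "on_curve A k p q r" and c': "on_curve A k p' q' r'"
    and "A < k" "0 \<le> k" "0 < p * p'" and D: "0 < 1 + p * p' + q * q'"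
  shows "axis2 A k p q r p' q' r' \<le> A"
proof -
  have A: "0 \<le> A" using curve_nonneg[OF c \<open>0 \<le> k\<close>] by simp
  have curve: "p^2 = 1 - q^2" "r^2 = A - k * q^2" "p'^2 = 1 - q'^2" "r'^2 = A - k * q'^2"
    using c c' by (simp_all add: on_curve_def)
  have eq: "(A*p*p')^2 - (r * r' + (k - A)*q*q')^2 = (k - A) * (r*q' - r'*q)^2"
    using curve by algebra
  have "0 \<le> (k - A) * (r*q' - r'*q)^2"
    using \<open>A < k\<close> by simp
  then have "(r * r' + (k - A)*q*q')^2 \<le> (A*p*p')^2"
    using eq by linarith
  moreover have "0 \<le> A*p*p'" using A \<open>0 < p * p'\<close> by (simp add: mult.assoc)
  ultimately have "r * r' + (k - A)*q*q' \<le> A*p*p'"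
    by (rule power2_le_imp_le)
  then show ?thesis
    using D by (simp add: axis2_def pos_divide_le_eq algebra_simps)
qed

section \<open>Bi-infinite sequences of lines generated by one shift\<close>

lemma int_shift_invariant_const:
  fixes f :: "int \<Rightarrow> 'a"
  assumes "\<And>i. f (i + 1) = f i"
  shows "f i = f j"
proof -
  have "f i = f 0" for i
  proof (induction i rule: int_induct[where k = 0])
    case (step2 i)
    then show ?case using assms[of "i - 1"] by simp
  qed (use assms in auto)
  from this[of i] this[of j] show ?thesis by simp
qed

text \<open>For \<open>k = 0\<close> the relation \<open>e^2 = 1\<close> leaves a sign open. With
  \<open>e = 1\<close> the shift keeps \<open>r\<close> and rotates the normal, as is right for a
  circle.\<close>

locale line_chain =
  fixes A k g t e :: real and p q r :: "int \<Rightarrow> real"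
  assumes k_nonneg: "0 \<le> k"
    and on_curve: "\<And>i. on_curve A k (p i) (q i) (r i)"
    and translation: "g^2 = 1 - A * t^2" "e^2 = 1 - k * t^2" "k = 0 \<Longrightarrow> e = 1"
    and shifted: "\<And>i. shifted k g t e (p i) (q i) (r i) (p (i + 1)) (q (i + 1)) (r (i + 1))"
    and r_sign: "\<And>i. k < A \<Longrightarrow> 0 < r i * r (i + 1)"
    and p_sign: "\<And>i. A < k \<Longrightarrow> p i * p (i + 1) < 0"
begin

lemma reversed:
  "shifted k g t e (- p (i + 1)) (- q (i + 1)) (- r (i + 1)) (- p i) (- q i) (- r i)"
  by (rule shifted_reverse[OF on_curve shifted translation(1,2)
        shifted[of "i + 1", unfolded shifted_def, THEN conjunct1]])

text \<open>Trajectories on an axis of the ellipse, for which the denominators of \<open>cn_diff\<close> and \<open>dn_diff\<close> vanish.\<close>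

lemma degenerate_parallel:
  assumes "A = 0 \<or> (A = k \<and> (q m)^2 = 1)"
  shows "p i * q j = p j * q i"
proof (cases "A = 0")
  case A: True
  show ?thesis
  proof (cases "k = 0")
    case False
    \<comment> \<open>All lines coincide with the axis \<open>x = 0\<close>.\<close>
    have "q i = 0" for i
    proof -
      have "(r i)^2 = - (k * (q i)^2)" using on_curve[of i] A by (simp add: on_curve_def)
      moreover have "0 \<le> k * (q i)^2" using k_nonneg by simp
      ultimately have "k * (q i)^2 = 0" using zero_le_power2[of "r i"] by linarith
      then show ?thesis using False by simp
    qed
    then show ?thesis by simp
  next
    case True
    have r: "r i = 0" for i using on_curve[of i] A True by (simp add: on_curve_def)
    have s: "p (i + 1) = g * p i" "q (i + 1) = g * q i" for i
      using shifted[of i, unfolded shifted_def] translation(3) True r by simp_all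
    have g: "g^2 = 1" using translation A by simp
    \<comment> \<open>All lines are diameters of the circle, and \<open>g\<close> is 1 or -1: the
      determinant changes at most its sign, and its square, constant in \<open>i\<close>, vanishes
      at \<open>i = j\<close>.\<close>
    have "p (i + 1) * q j - p j * q (i + 1) = g * (p i * q j - p j * q i)" for i
      unfolding s by (simp add: algebra_simps)
    then have "(p (i + 1) * q j - p j * q (i + 1))^2 = (p i * q j - p j * q i)^2" for i
      by (simp add: power_mult_distrib g)
    then have "(p i * q j - p j * q i)^2 = (p j * q j - p j * q j)^2"
      by (rule int_shift_invariant_const[where f = "\<lambda>i. (p i * q j - p j * q i)^2"])
    then show ?thesis by simp
  qed
next
  case False
  then have A: "A = k" "(q m)^2 = 1" using assms by auto
  \<comment> \<open>Here \<open>(q i)^2 = 1\<close> means that the line is the focal axis. The shift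
    preserves this, and so does its inverse, which \<open>reversed\<close> supplies.\<close>
  have "(q (i + 1))^2 = 1 \<longleftrightarrow> (q i)^2 = 1" for i
  proof
    assume "(q i)^2 = 1"
    then have "p i = 0" "r i = 0" using on_curve[of i] A by (simp_all add: on_curve_def)
    then have "(1 - k * t^2 * (q i)^2) * p (i + 1) = 0"
      using shifted[of i, unfolded shifted_def, THEN conjunct2, THEN conjunct1] by simp
    then have "p (i + 1) = 0"
      using shifted[of i, unfolded shifted_def, THEN conjunct1] by simp
    then show "(q (i + 1))^2 = 1" using on_curve[of "i + 1"] by (simp add: on_curve_def)
  next
    assume "(q (i + 1))^2 = 1"
    then have "p (i + 1) = 0" "r (i + 1) = 0" using on_curve[of "i + 1"] A by (simp_all add: on_curve_def)
    then have "(1 - k * t^2 * (- q (i + 1))^2) * (- p i) = 0"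
      using reversed[of i, unfolded shifted_def, THEN conjunct2, THEN conjunct1] by simp
    then have "p i = 0"
      using reversed[of i, unfolded shifted_def, THEN conjunct1] by simp
    then show "(q i)^2 = 1" using on_curve[of i] by (simp add: on_curve_def)
  qed
  then have "((q i)^2 = 1) = ((q m)^2 = 1)" for i
    by (rule int_shift_invariant_const[where f = "\<lambda>i. (q i)^2 = 1"])
  then have "p i = 0" for i using A on_curve[of i] by (simp add: on_curve_def)
  then show ?thesis by simp
qed

text \<open>The second chain will be the first one with its index moved (for \<open>P_set\<close>),
  or the reversed lines in backward order (for \<open>Q_set\<close>).\<close>

lemma axis2_const:
  fixes p' q' r' :: "int \<Rightarrow> real"
  assumes c': "\<And>i. on_curve A k (p' i) (q' i) (r' i)"
    and s': "\<And>i. shifted k g t e (p' i) (q' i) (r' i) (p' (i + 1)) (q' (i + 1)) (r' (i + 1))"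
    and nondeg: "A \<noteq> 0" "\<And>i. \<not> (A = k \<and> (q i)^2 = 1)"
    and D: "1 + p i * p' i + q i * q' i \<noteq> 0" "1 + p j * p' j + q j * q' j \<noteq> 0"
  shows "axis2 A k (p i) (q i) (r i) (p' i) (q' i) (r' i) = axis2 A k (p j) (q j) (r j) (p' j) (q' j) (r' j)"
proof -
  have den: "A - k * (q i)^2 * (q' i)^2 \<noteq> 0" for i
    using diff_denominator_pos[OF on_curve c' k_nonneg nondeg] by (simp add: order_less_imp_not_eq2)
  let ?c = "\<lambda>i. cn_diff A k (p i) (q i) (r i) (p' i) (q' i) (r' i)"
  let ?d = "\<lambda>i. dn_diff A k (p i) (q i) (r i) (p' i) (q' i) (r' i)"
  have step: "?c (i + 1) = ?c i" "?d (i + 1) = ?d i" for i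
    using diff_translate[OF on_curve c' shifted s' translation(1,2) den den] by auto
  have eq: "?c j = ?c i" "?d j = ?d i"
    by (rule int_shift_invariant_const[where f = ?c], rule step)
      (rule int_shift_invariant_const[where f = ?d], rule step)
  show ?thesis
    using axis2_determined[OF axis2_diff[OF on_curve c' den D(1)]
        axis2_diff[OF on_curve c' den D(2), unfolded eq] nondeg(1)] .
qed

lemma axis2_P:
  "\<exists>\<alpha>. \<forall>i j. i - j = m \<longrightarrow> p j * q i \<noteq> p i * q j \<longrightarrow>
      axis2 A k (p j) (q j) (r j) (p i) (q i) (r i) = \<alpha>"
\<comment> \<open>One pair of non-parallel lines excludes the degenerate trajectories and supplies
  \<alpha>; without such a pair any \<alpha> will do.\<close>
proof (cases "\<exists>i. p i * q (i + m) \<noteq> p (i + m) * q i")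
  case True
  then obtain i0 where i0: "p i0 * q (i0 + m) \<noteq> p (i0 + m) * q i0" by blast
  then have nondeg: "A \<noteq> 0" "\<not> (A = k \<and> (q i)^2 = 1)" for i
    using degenerate_parallel by blast+
  have D: "1 + p i * p j + q i * q j \<noteq> 0" if "p i * q j \<noteq> p j * q i" for i j
  proof
    assume "1 + p i * p j + q i * q j = 0"
    then have "(p i * q j - p j * q i)^2 = 0"
      using on_curve[of i, unfolded on_curve_def, THEN conjunct1]
        on_curve[of j, unfolded on_curve_def, THEN conjunct1] by algebra
    then show False using that by simp
  qed
  show ?thesis
  proof (intro exI allI impI)
    fix i j :: int
    assume "i - j = m" and ij: "p j * q i \<noteq> p i * q j"
    then have i: "i = j + m" by simp
    have s: "shifted k g t e (p (i + m)) (q (i + m)) (r (i + m)) (p (i + 1 + m)) (q (i + 1 + m)) (r (i + 1 + m))" for i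
      using shifted[of "i + m"] by (simp add: ac_simps)
    show "axis2 A k (p j) (q j) (r j) (p i) (q i) (r i)
      = axis2 A k (p i0) (q i0) (r i0) (p (i0 + m)) (q (i0 + m)) (r (i0 + m))"
      unfolding i by (rule axis2_const[where p' = "\<lambda>i. p (i + m)" and q' = "\<lambda>i. q (i + m)" and r' = "\<lambda>i. r (i + m)"])
        (use on_curve s nondeg ij i i0 D in simp_all)
  qed
next
  case False
  have "p j * q i = p i * q j" if "i - j = m" for i j
  proof -
    have "i = j + m" using that by simp
    then show ?thesis using False by simp
  qed
  then show ?thesis by blast
qed

text \<open>As \<open>i\<close> grows, line \<open>m - i\<close> runs backward. Once its orientation
  is reversed, it moves by the same forward shift as line \<open>i\<close>, and
  \<open>axis2_const\<close> applies.\<close>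

lemma axis2_Q:
  "\<exists>\<alpha>. \<forall>i j. i + j = m \<longrightarrow> p i * q j \<noteq> p j * q i \<longrightarrow>
      axis2 A k (p i) (q i) (r i) (- p j) (- q j) (- r j) = \<alpha>"
proof (cases "\<exists>i. p i * q (m - i) \<noteq> p (m - i) * q i")
  case True
  then obtain i0 where i0: "p i0 * q (m - i0) \<noteq> p (m - i0) * q i0" by blast
  then have nondeg: "A \<noteq> 0" "\<not> (A = k \<and> (q i)^2 = 1)" for i
    using degenerate_parallel by blast+
  have D: "1 + p i * (- p j) + q i * (- q j) \<noteq> 0" if "p i * q j \<noteq> p j * q i" for i j
  proof
    assume "1 + p i * (- p j) + q i * (- q j) = 0"
    then have "(p i * q j - p j * q i)^2 = 0"
      using on_curve[of i, unfolded on_curve_def, THEN conjunct1]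
        on_curve[of j, unfolded on_curve_def, THEN conjunct1] by algebra
    then show False using that by simp
  qed
  show ?thesis
  proof (intro exI allI impI)
    fix i j :: int
    assume "i + j = m" and ij: "p i * q j \<noteq> p j * q i"
    then have j: "j = m - i" by simp
    have c: "on_curve A k (- p (m - i)) (- q (m - i)) (- r (m - i))" for i
      using on_curve[of "m - i"] by (simp add: on_curve_def)
    have s: "shifted k g t e (- p (m - i)) (- q (m - i)) (- r (m - i))
        (- p (m - (i + 1))) (- q (m - (i + 1))) (- r (m - (i + 1)))" for i
      using reversed[of "m - (i + 1)"] by simp
    show "axis2 A k (p i) (q i) (r i) (- p j) (- q j) (- r j)
      = axis2 A k (p i0) (q i0) (r i0) (- p (m - i0)) (- q (m - i0)) (- r (m - i0))"
      unfolding j by (rule axis2_const[where p' = "\<lambda>i. - p (m - i)" and q' = "\<lambda>i. - q (m - i)" and r' = "\<lambda>i. - r (m - i)"])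
        (use c s nondeg ij j i0 D in simp_all)
  qed
next
  case False
  have "p i * q j = p j * q i" if "i + j = m" for i j
  proof -
    have "j = m - i" using that by simp
    then show ?thesis using False by simp
  qed
  then show ?thesis by blast
qed

lemma r_same_sign:
  assumes "k < A"
  shows "0 < r i * r j"
proof -
  have "r (i + 1) > 0 \<longleftrightarrow> r i > 0" "r i \<noteq> 0" for i
    using r_sign[OF assms, of i] by (auto simp: zero_less_mult_iff)
  then have "(r i > 0) = (r j > 0)" "r i \<noteq> 0" "r j \<noteq> 0"
    using int_shift_invariant_const[of "\<lambda>i. r i > 0"] by auto
  then show ?thesis by (auto simp: zero_less_mult_iff)
qed

lemma p_alternating:
  assumes "A < k"
  shows "0 < p i * p j \<longleftrightarrow> even (i - j)" and "p i \<noteq> 0"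
proof -
  have "(p (i + 1) > 0) = even (i + 1) \<longleftrightarrow> (p i > 0) = even i" and nz: "p i \<noteq> 0" for i
    using p_sign[OF assms, of i] by (auto simp: mult_less_0_iff)
  then have "((p i > 0) = even i) = ((p j > 0) = even j)"
    using int_shift_invariant_const[of "\<lambda>i. (p i > 0) = even i"] by auto
  then show "0 < p i * p j \<longleftrightarrow> even (i - j)"
    using nz[of i] nz[of j] by (auto simp: zero_less_mult_iff)
  show "p i \<noteq> 0" by (rule nz)
qed

end

section \<open>Confocal conics in coordinates\<close>

locale focal_frame =
  fixes F1 F2 e1 e2 :: plane and c :: real
  assumes frame: "e1 \<bullet> e1 = 1" "e2 \<bullet> e2 = 1" "e1 \<bullet> e2 = 0"
    and c_nonneg: "0 \<le> c" and foci: "F2 - F1 = (2 * c) *\<^sub>R e1"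
begin

definition xc :: "plane \<Rightarrow> real" where "xc X = (X - midpoint F1 F2) \<bullet> e1"
definition yc :: "plane \<Rightarrow> real" where "yc X = (X - midpoint F1 F2) \<bullet> e2"

lemma inner_frame: "u \<bullet> w = (u \<bullet> e1) * (w \<bullet> e1) + (u \<bullet> e2) * (w \<bullet> e2)"
proof -
  define a b c d where "a = e1 $ 1" and "b = e1 $ 2" and "c = e2 $ 1" and "d = e2 $ 2"
  have "a^2 + b^2 = 1" "c^2 + d^2 = 1" "a * c + b * d = 0"
    using frame by (simp_all add: inner_vec_def sum_2 a_def b_def c_def d_def power2_eq_square)
  \<comment> \<open>A square matrix with orthonormal rows has orthonormal columns.\<close>
  then have "a^2 + c^2 = 1" "b^2 + d^2 = 1" "a * b + c * d = 0"
    by algebra+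
  then have "(u $ 1 * a + u $ 2 * b) * (w $ 1 * a + w $ 2 * b) + (u $ 1 * c + u $ 2 * d) * (w $ 1 * c + w $ 2 * d)
      = u $ 1 * w $ 1 + u $ 2 * w $ 2"
    by algebra
  then show ?thesis by (simp add: inner_vec_def sum_2 a_def b_def c_def d_def)
qed

lemma eq_frame: "u = w \<longleftrightarrow> u \<bullet> e1 = w \<bullet> e1 \<and> u \<bullet> e2 = w \<bullet> e2"
  by (metis inner_frame vector_eq_rdot)

lemma norm_frame: "(norm u)^2 = (u \<bullet> e1)^2 + (u \<bullet> e2)^2"
proof -
  have "(norm u)^2 = u \<bullet> u" by (simp add: power2_norm_eq_inner)
  also have "\<dots> = (u \<bullet> e1)^2 + (u \<bullet> e2)^2" by (subst inner_frame) (simp add: power2_eq_square)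
  finally show ?thesis .
qed

lemma coords_diff: "(X - Y) \<bullet> e1 = xc X - xc Y" "(X - Y) \<bullet> e2 = yc X - yc Y"
  by (simp_all add: xc_def yc_def inner_diff_left)

lemma coords_eq: "X = Y \<longleftrightarrow> xc X = xc Y \<and> yc X = yc Y"
  using eq_frame[of "X - Y" 0] by (simp add: coords_diff)

lemma coords_add: "xc (X + u) = xc X + u \<bullet> e1" "yc (X + u) = yc X + u \<bullet> e2"
  by (simp_all add: xc_def yc_def inner_diff_left inner_add_left)

lemma frame_swap: "e2 \<bullet> e1 = 0"
  using frame by (simp add: inner_commute)

lemma coords_foci: "xc F1 = - c" "yc F1 = 0" "xc F2 = c" "yc F2 = 0"
proof -
  have F2: "F2 = F1 + (2 * c) *\<^sub>R e1" using foci by (simp add: algebra_simps)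
  have mid: "midpoint F1 F2 = F1 + c *\<^sub>R e1"
    unfolding F2 by (simp add: vec_eq_iff midpoint_def field_simps)
  show "xc F1 = - c" "yc F1 = 0" "xc F2 = c" "yc F2 = 0"
    unfolding xc_def yc_def mid by (simp_all add: F2 frame inner_diff_left inner_add_left)
qed

lemma dist_foci: "dist F1 F2 = 2 * c"
proof -
  have "norm e1 = 1" using frame by (simp add: norm_eq_1)
  then show ?thesis using c_nonneg by (simp add: dist_norm norm_minus_commute[of F1] foci)
qed

lemma dist_focus: "(dist X F1)^2 = (xc X + c)^2 + (yc X)^2" "(dist X F2)^2 = (xc X - c)^2 + (yc X)^2"
  by (simp_all add: dist_norm norm_frame coords_diff coords_foci)

lemma dist_focus_bounds: "\<bar>dist X F1 - dist X F2\<bar> \<le> 2 * c" "2 * c \<le> dist X F1 + dist X F2"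
  using abs_dist_diff_le[of F1 X F2] dist_triangle3[of F1 F2 X]
  by (simp_all add: dist_foci[symmetric] dist_commute)

text \<open>So the squared semi-axes of the two conics through \<open>X\<close> are the roots of a quadratic.\<close>

lemma confocal_quadratic:
  "16 * (\<alpha>^2 - \<alpha> * ((xc X)^2 + (yc X)^2 + c^2) + c^2 * (xc X)^2)
    = (4 * \<alpha> - (dist X F1 + dist X F2)^2) * (4 * \<alpha> - (dist X F1 - dist X F2)^2)"
  using dist_focus[of X] by algebra

text \<open>By the triangle inequality the factor of \<open>confocal_quadratic\<close> with the
  difference of the distances is nonzero when \<open>c^2 < \<alpha>\<close>, so the factor with
  their sum vanishes. For \<open>\<alpha> < c^2\<close> the roles are exchanged.\<close>

lemma mem_ellipse_sqrt:
  assumes "\<alpha>^2 - \<alpha> * ((xc X)^2 + (yc X)^2 + c^2) + c^2 * (xc X)^2 = 0" and "c^2 < \<alpha>"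
  shows "X \<in> ellipse F1 F2 (sqrt \<alpha>)"
proof -
  have "(dist X F1 - dist X F2)^2 \<le> (2 * c)^2"
    using dist_focus_bounds(1)[of X] by (metis abs_le_square_iff abs_of_nonneg abs_ge_zero order_trans)
  then have "4 * \<alpha> - (dist X F1 - dist X F2)^2 \<noteq> 0"
    using assms(2) by (simp add: power_mult_distrib)
  then have "(dist X F1 + dist X F2)^2 = 2^2 * \<alpha>"
    using confocal_quadratic[of \<alpha> X] assms(1) by simp
  then have "dist X F1 + dist X F2 = sqrt (2^2 * \<alpha>)"
    by (metis add_nonneg_nonneg real_sqrt_unique zero_le_dist)
  then show ?thesis by (simp add: ellipse_def real_sqrt_mult)
qed

lemma abs_dist_diff_sqrt:
  assumes "\<alpha>^2 - \<alpha> * ((xc X)^2 + (yc X)^2 + c^2) + c^2 * (xc X)^2 = 0" and "\<alpha> < c^2"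
  shows "\<bar>dist X F1 - dist X F2\<bar> = 2 * sqrt \<alpha>"
proof -
  have "(2 * c)^2 \<le> (dist X F1 + dist X F2)^2"
    using dist_focus_bounds(2)[of X] c_nonneg by (intro power_mono) simp_all
  then have "4 * \<alpha> - (dist X F1 + dist X F2)^2 \<noteq> 0"
    using assms(2) by (simp add: power_mult_distrib)
  then have "\<bar>dist X F1 - dist X F2\<bar>^2 = 2^2 * \<alpha>"
    using confocal_quadratic[of \<alpha> X] assms(1) by simp
  then have "\<bar>dist X F1 - dist X F2\<bar> = sqrt (2^2 * \<alpha>)"
    by (metis abs_ge_zero real_sqrt_unique)
  then show ?thesis by (simp add: real_sqrt_mult)
qed

lemma dist_focus_axis:
  assumes "yc X = 0"
  shows "dist X F1 = \<bar>xc X + c\<bar>" "dist X F2 = \<bar>xc X - c\<bar>"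
  by (rule power2_eq_imp_eq; simp add: dist_focus assms)+

lemma mem_focal_segment:
  assumes "yc X = 0" "(xc X)^2 \<le> c^2"
  shows "X \<in> closed_segment F1 F2"
proof -
  have x: "\<bar>xc X\<bar> \<le> c" using assms(2) c_nonneg by (metis abs_le_square_iff abs_of_nonneg)
  have "dist X F1 = xc X + c" "dist X F2 = c - xc X"
    using dist_focus_axis[OF assms(1)] x by auto
  then have "dist F1 F2 = dist F1 X + dist X F2"
    by (simp add: dist_foci dist_commute)
  then show ?thesis by (simp add: between between_mem_segment[symmetric])
qed

lemma mem_focal_rays:
  assumes "yc X = 0" "c^2 \<le> (xc X)^2" "0 < c"
  shows "X \<in> affine hull {F1, F2} - open_segment F1 F2"
proof
  have "X = F1 + ((xc X + c) / (2 * c)) *\<^sub>R (F2 - F1)"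
    unfolding coords_eq coords_add using assms(1,3) by (simp add: coords_foci foci frame)
  then show "X \<in> affine hull {F1, F2}" unfolding affine_hull_2_alt by blast
  show "X \<notin> open_segment F1 F2"
  proof
    assume "X \<in> open_segment F1 F2"
    then have cl: "X \<in> closed_segment F1 F2" and ne: "X \<noteq> F1" "X \<noteq> F2"
      by (auto simp: open_segment_def)
    have "dist X F1 + dist X F2 = 2 * c"
      using cl by (simp add: between_mem_segment[symmetric] between dist_foci dist_commute)
    moreover have "xc X \<noteq> - c" "xc X \<noteq> c" using ne assms(1) by (auto simp: coords_eq coords_foci)
    moreover have "c \<le> \<bar>xc X\<bar>" using assms(2,3) by (metis abs_le_square_iff abs_of_pos)
    ultimately show False
      using dist_focus_axis[OF assms(1)] assms(3) by (auto simp: abs_if split: if_splits)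
  qed
qed

section \<open>Placing a set of points on a single conic\<close>

lemma covered_by_ellipse:
  assumes "\<And>X. X \<in> S \<Longrightarrow> c^2 < \<alpha> \<and> (\<exists>\<beta>. \<alpha> + \<beta> = (xc X)^2 + (yc X)^2 + c^2 \<and> \<alpha> * \<beta> = c^2 * (xc X)^2)"
  shows "\<exists>C. confocal_ellipse F1 F2 C \<and> S \<subseteq> C"
proof (cases "S = {}")
  case True
  \<comment> \<open>The empty set still needs a genuine ellipse; any semi-axis above
    \<open>c\<close> gives one.\<close>
  have "confocal_ellipse F1 F2 (ellipse F1 F2 (c + 1))"
    unfolding confocal_ellipse_def dist_foci by (intro exI[of _ "c + 1"]) simp
  then show ?thesis using True by blast
next
  case False
  then have "c^2 < \<alpha>" using assms by blast
  then have "c < sqrt \<alpha>" by (simp add: real_less_rsqrt)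
  then have "confocal_ellipse F1 F2 (ellipse F1 F2 (sqrt \<alpha>))"
    unfolding confocal_ellipse_def dist_foci by (intro exI[of _ "sqrt \<alpha>"]) simp
  moreover have "S \<subseteq> ellipse F1 F2 (sqrt \<alpha>)"
  proof
    fix X assume "X \<in> S"
    then obtain \<beta> where "\<alpha> + \<beta> = (xc X)^2 + (yc X)^2 + c^2" "\<alpha> * \<beta> = c^2 * (xc X)^2"
      using assms by blast
    then have "\<alpha>^2 - \<alpha> * ((xc X)^2 + (yc X)^2 + c^2) + c^2 * (xc X)^2 = 0" by algebra
    then show "X \<in> ellipse F1 F2 (sqrt \<alpha>)" using \<open>c^2 < \<alpha>\<close> by (rule mem_ellipse_sqrt)
  qed
  ultimately show ?thesis by blast
qed

text \<open>The quadratic takes the value \<open>- (c * y)^2\<close> at \<open>c^2\<close>, so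
  \<open>c^2\<close> lies between the roots: one conic is of elliptic type, the other of hyperbolic
  type.\<close>

lemma roots_separated:
  fixes \<alpha> \<beta> x y :: real
  assumes "\<alpha> + \<beta> = x^2 + y^2 + c^2" "\<alpha> * \<beta> = c^2 * x^2"
  shows "\<beta> < c^2 \<Longrightarrow> c^2 \<le> \<alpha>" and "c^2 < \<beta> \<Longrightarrow> \<alpha> \<le> c^2"
    and "0 \<le> \<alpha>"
proof -
  have eq: "(\<alpha> - c^2) * (\<beta> - c^2) = - ((c * y)^2)"
    using assms by algebra
  then have le: "(\<alpha> - c^2) * (\<beta> - c^2) \<le> 0" by simp
  show "\<beta> < c^2 \<Longrightarrow> c^2 \<le> \<alpha>" "c^2 < \<beta> \<Longrightarrow> \<alpha> \<le> c^2"
    using le by (auto simp: mult_le_0_iff)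
  have "0 \<le> \<alpha> * \<beta>" "0 \<le> \<alpha> + \<beta>" using assms by simp_all
  then show "0 \<le> \<alpha>" by (auto simp: zero_le_mult_iff)
qed

lemma double_root_on_axis:
  fixes \<beta> x y :: real
  assumes "c^2 + \<beta> = x^2 + y^2 + c^2" "c^2 * \<beta> = c^2 * x^2" "0 < c"
  shows "\<beta> = x^2" "y = 0"
  using assms by auto

text \<open>The bound on the other root forces \<open>c^2 \<le> \<alpha>\<close>. Equality puts the
  points on the focal axis with \<open>x^2 = \<beta> < c^2\<close>, hence between the foci.\<close>

lemma covered_by_ellipse_or_limit:
  assumes "\<And>X. X \<in> S \<Longrightarrow> \<exists>\<beta>. \<alpha> + \<beta> = (xc X)^2 + (yc X)^2 + c^2 \<and> \<alpha> * \<beta> = c^2 * (xc X)^2 \<and> \<beta> < c^2"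
  shows "\<exists>C. ellipse_or_limit F1 F2 C \<and> S \<subseteq> C"
proof (cases "S = {} \<or> c^2 < \<alpha>")
  case True
  then have "\<exists>C. confocal_ellipse F1 F2 C \<and> S \<subseteq> C"
    using assms by (intro covered_by_ellipse[of S \<alpha>]) blast
  then show ?thesis unfolding ellipse_or_limit_def by blast
next
  case False
  then obtain X where "X \<in> S" by blast
  then obtain \<beta> where "\<alpha> + \<beta> = (xc X)^2 + (yc X)^2 + c^2" "\<alpha> * \<beta> = c^2 * (xc X)^2" "\<beta> < c^2"
    using assms by blast
  with roots_separated(1)[OF this(1,2)] False have \<alpha>: "\<alpha> = c^2" by simp
  have "S \<subseteq> closed_segment F1 F2"
  proof
    fix X assume "X \<in> S"
    then obtain \<beta> where \<beta>: "c^2 + \<beta> = (xc X)^2 + (yc X)^2 + c^2" "c^2 * \<beta> = c^2 * (xc X)^2" "\<beta> < c^2"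
      using assms unfolding \<alpha> by blast
    show "X \<in> closed_segment F1 F2"
    proof (cases "c = 0")
      case True
      then have "(xc X)^2 + (yc X)^2 < 0" using \<beta> by simp
      then show ?thesis by (simp add: not_sum_power2_lt_zero)
    next
      case False
      then have "0 < c" using c_nonneg by simp
      then show ?thesis using double_root_on_axis[OF \<beta>(1,2)] \<beta>(3) by (intro mem_focal_segment) simp_all
    qed
  qed
  then show ?thesis unfolding ellipse_or_limit_def limit_ellipse_def by blast
qed

lemma ex_limit_hyperbola: "\<exists>C. limit_hyperbola F1 F2 C"
proof (cases "F1 = F2")
  case True
  have "F1 + e1 \<noteq> F1" using frame by auto
  then have "limit_hyperbola F1 F2 (affine hull {F1, F1 + e1})"
    unfolding limit_hyperbola_def if_P[OF True] by blast
  then show ?thesis ..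
qed (auto simp: limit_hyperbola_def)

text \<open>Here \<open>\<alpha> = c^2\<close> is possible only with \<open>c^2 < \<beta>\<close>,
  which places the points on the outer rays of the focal axis; \<open>\<alpha> = 0\<close> means
  \<open>x = 0\<close>, the bisector of the foci. Every other \<alpha> gives a genuine
  hyperbola.\<close>

lemma covered_by_hyperbola_or_limit:
  assumes c: "S \<noteq> {} \<Longrightarrow> 0 < c"
    and S: "\<And>X. X \<in> S \<Longrightarrow> \<exists>\<beta>. \<alpha> + \<beta> = (xc X)^2 + (yc X)^2 + c^2 \<and> \<alpha> * \<beta> = c^2 * (xc X)^2
          \<and> (\<alpha> < c^2 \<or> c^2 < \<beta>)"
  shows "\<exists>C. hyperbola_or_limit F1 F2 C \<and> S \<subseteq> C"
proof (cases "S = {}")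
  case True
  then show ?thesis using ex_limit_hyperbola by (auto simp: hyperbola_or_limit_def)
next
  case False
  then have "0 < c" using c by simp
  then have F: "F1 \<noteq> F2" using dist_foci by auto
  obtain X0 where "X0 \<in> S" using False by blast
  then obtain \<beta>0 where \<beta>0: "\<alpha> + \<beta>0 = (xc X0)^2 + (yc X0)^2 + c^2" "\<alpha> * \<beta>0 = c^2 * (xc X0)^2"
      "\<alpha> < c^2 \<or> c^2 < \<beta>0"
    using S by blast
  then consider "\<alpha> = c^2" | "\<alpha> = 0" | "0 < \<alpha>" "\<alpha> < c^2"
    using roots_separated(2,3)[OF \<beta>0(1,2)] by linarith
  then show ?thesis
  proof cases
    case 1
    have "S \<subseteq> affine hull {F1, F2} - open_segment F1 F2"
    proof
      fix X assume "X \<in> S"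
      then obtain \<beta> where \<beta>: "c^2 + \<beta> = (xc X)^2 + (yc X)^2 + c^2" "c^2 * \<beta> = c^2 * (xc X)^2" "c^2 < \<beta>"
        using S 1 by blast
      show "X \<in> affine hull {F1, F2} - open_segment F1 F2"
        using double_root_on_axis[OF \<beta>(1,2) \<open>0 < c\<close>] \<beta>(3) \<open>0 < c\<close> by (intro mem_focal_rays) simp_all
    qed
    then show ?thesis using F unfolding hyperbola_or_limit_def limit_hyperbola_def by auto
  next
    case 2
    have "S \<subseteq> {X. dist X F1 = dist X F2}"
    proof
      fix X assume "X \<in> S"
      then have "0 = c^2 * (xc X)^2" using S 2 by fastforce
      then have "0^2 - 0 * ((xc X)^2 + (yc X)^2 + c^2) + c^2 * (xc X)^2 = 0" by simp
      from abs_dist_diff_sqrt[OF this] \<open>0 < c\<close> show "X \<in> {X. dist X F1 = dist X F2}" by simp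
    qed
    then show ?thesis using F unfolding hyperbola_or_limit_def limit_hyperbola_def by auto
  next
    case 3
    have "sqrt \<alpha> < c" using 3 \<open>0 < c\<close> by (simp add: real_less_lsqrt)
    then have "confocal_hyperbola F1 F2 (hyperbola F1 F2 (sqrt \<alpha>))"
      unfolding confocal_hyperbola_def dist_foci using 3 by (intro exI[of _ "sqrt \<alpha>"]) simp
    moreover have "S \<subseteq> hyperbola F1 F2 (sqrt \<alpha>)"
    proof
      fix X assume "X \<in> S"
      then obtain \<beta> where "\<alpha> + \<beta> = (xc X)^2 + (yc X)^2 + c^2" "\<alpha> * \<beta> = c^2 * (xc X)^2"
        using S by blast
      then have "\<alpha>^2 - \<alpha> * ((xc X)^2 + (yc X)^2 + c^2) + c^2 * (xc X)^2 = 0" by algebra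
      from abs_dist_diff_sqrt[OF this 3(2)] show "X \<in> hyperbola F1 F2 (sqrt \<alpha>)"
        by (simp add: hyperbola_def)
    qed
    ultimately show ?thesis unfolding hyperbola_or_limit_def by blast
  qed
qed

section \<open>Equations, normals and tangents of the conics\<close>

lemma sgn_coords:
  "sgn (X - Y) \<bullet> e1 = (xc X - xc Y) / dist X Y" "sgn (X - Y) \<bullet> e2 = (yc X - yc Y) / dist X Y"
  by (simp_all add: sgn_div_norm dist_norm coords_diff divide_inverse mult.commute)

text \<open>The second part passes from the gradient of the sum of distances to that of the
  quadratic equation.\<close>

lemma ellipse_equation:
  assumes X: "X \<in> ellipse F1 F2 a" and "c < a"
  shows "(xc X)^2 / a^2 + (yc X)^2 / (a^2 - c^2) = 1"
    and "\<exists>\<kappa>>0. ellipse_normal F1 F2 X \<bullet> e1 = \<kappa> * (xc X / a^2) \<and>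
               ellipse_normal F1 F2 X \<bullet> e2 = \<kappa> * (yc X / (a^2 - c^2))"
proof -
  define x y d1 d2 where "x = xc X" and "y = yc X" and "d1 = dist X F1" and "d2 = dist X F2"
  have a: "0 < a" using c_nonneg \<open>c < a\<close> by simp
  have b: "0 < a^2 - c^2" using c_nonneg \<open>c < a\<close> by (simp add: power_strict_mono)
  have d: "d1^2 = (x + c)^2 + y^2" "d2^2 = (x - c)^2 + y^2" "d1 + d2 = 2 * a"
    using dist_focus[of X] X by (simp_all add: d1_def d2_def x_def y_def ellipse_def)
  have le: "\<bar>d1 - d2\<bar> \<le> 2 * c" using dist_focus_bounds(1) by (simp add: d1_def d2_def)
  have pos: "0 < d1" "0 < d2" using le d(3) \<open>c < a\<close> by linarith+
  \<comment> \<open>The difference of the squared distances is \<open>4 * c * x\<close>, and their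
    sum of first powers is \<open>2 * a\<close>.\<close>
  have diff: "a * (d1 - d2) = 2 * c * x" using d by algebra
  have "(a^2 - c^2) * x^2 + a^2 * y^2 = a^2 * (a^2 - c^2)" using d diff a by algebra
  moreover have "x^2 / a^2 + y^2 / (a^2 - c^2) = ((a^2 - c^2) * x^2 + a^2 * y^2) / (a^2 * (a^2 - c^2))"
    using a b by (simp add: add_frac_eq mult.commute)
  ultimately show "(xc X)^2 / a^2 + (yc X)^2 / (a^2 - c^2) = 1"
    using a b unfolding x_def y_def by simp
  \<comment> \<open>Read off from the second component,
    \<open>y * (d1 + d2) / (d1 * d2)\<close>.\<close>
  define \<kappa> where "\<kappa> = 2 * a * (a^2 - c^2) / (d1 * d2)"
  have "\<kappa> > 0" using a b pos by (simp add: \<kappa>_def)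
  have n: "ellipse_normal F1 F2 X \<bullet> e1 = (x + c) / d1 + (x - c) / d2"
    "ellipse_normal F1 F2 X \<bullet> e2 = y / d1 + y / d2"
    by (simp_all add: ellipse_normal_def inner_add_left sgn_coords coords_foci x_def y_def d1_def d2_def)
  have "a * (x * (d1 + d2) + c * (d2 - d1)) = 2 * (a^2 - c^2) * x"
    using d(3) diff by algebra
  then have "x * (d1 + d2) + c * (d2 - d1) = 2 * (a^2 - c^2) * x / a"
    using a by (simp add: field_simps)
  moreover have "(x + c) / d1 + (x - c) / d2 = (x * (d1 + d2) + c * (d2 - d1)) / (d1 * d2)"
    using pos by (simp add: field_simps)
  ultimately have "(x + c) / d1 + (x - c) / d2 = (2 * (a^2 - c^2) * x / a) / (d1 * d2)"
    by (simp only:)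
  also have "\<dots> = \<kappa> * (x / a^2)"
    using a pos unfolding \<kappa>_def by (simp add: field_simps power2_eq_square)
  finally have "(x + c) / d1 + (x - c) / d2 = \<kappa> * (x / a^2)" .
  moreover have "y / d1 + y / d2 = \<kappa> * (y / (a^2 - c^2))"
  proof -
    have "y / d1 + y / d2 = y * (d1 + d2) / (d1 * d2)" using pos by (simp add: field_simps)
    then show ?thesis unfolding d(3) \<kappa>_def using b by simp
  qed
  ultimately show "\<exists>\<kappa>>0. ellipse_normal F1 F2 X \<bullet> e1 = \<kappa> * (xc X / a^2) \<and>
               ellipse_normal F1 F2 X \<bullet> e2 = \<kappa> * (yc X / (a^2 - c^2))"
    using n \<open>\<kappa> > 0\<close> unfolding x_def y_def by auto
qed

lemma hyperbola_equation:
  assumes X: "X \<in> hyperbola F1 F2 a" and "0 < a" "a < c"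
  shows "(xc X)^2 / a^2 + (yc X)^2 / (a^2 - c^2) = 1"
    and "\<exists>\<kappa>. \<kappa> \<noteq> 0 \<and> hyperbola_normal F1 F2 X \<bullet> e1 = \<kappa> * (xc X / a^2) \<and>
               hyperbola_normal F1 F2 X \<bullet> e2 = \<kappa> * (yc X / (a^2 - c^2))"
proof -
  define x y d1 d2 where "x = xc X" and "y = yc X" and "d1 = dist X F1" and "d2 = dist X F2"
  \<comment> \<open>A signed semi-axis treats both branches at once.\<close>
  define a' where "a' = (d1 - d2) / 2"
  have "\<bar>a'\<bar> = a" using X by (simp add: a'_def d1_def d2_def hyperbola_def)
  then have a: "a' \<noteq> 0" "a'^2 = a^2" using \<open>0 < a\<close> by (auto simp: power2_abs[of a', symmetric] simp del: power2_abs)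
  have b: "a^2 - c^2 < 0" using \<open>0 < a\<close> \<open>a < c\<close> by (simp add: power_strict_mono)
  have d: "d1^2 = (x + c)^2 + y^2" "d2^2 = (x - c)^2 + y^2" "d1 - d2 = 2 * a'"
    using dist_focus[of X] by (simp_all add: d1_def d2_def x_def y_def a'_def)
  have le: "2 * c \<le> d1 + d2" using dist_focus_bounds(2) by (simp add: d1_def d2_def)
  have pos: "0 < d1" "0 < d2" using le d(3) \<open>a < c\<close> \<open>\<bar>a'\<bar> = a\<close> by linarith+
  have sum: "a' * (d1 + d2) = 2 * c * x" using d by algebra
  have "(a^2 - c^2) * x^2 + a^2 * y^2 = a^2 * (a^2 - c^2)" using d sum a(2) by algebra
  moreover have "x^2 / a^2 + y^2 / (a^2 - c^2) = ((a^2 - c^2) * x^2 + a^2 * y^2) / (a^2 * (a^2 - c^2))"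
    using \<open>0 < a\<close> b by (simp add: add_frac_eq mult.commute)
  ultimately show "(xc X)^2 / a^2 + (yc X)^2 / (a^2 - c^2) = 1"
    using \<open>0 < a\<close> b unfolding x_def y_def by simp
  define \<kappa> where "\<kappa> = - 2 * a' * (a^2 - c^2) / (d1 * d2)"
  have "\<kappa> \<noteq> 0" using a b pos by (simp add: \<kappa>_def)
  have n: "hyperbola_normal F1 F2 X \<bullet> e1 = (x + c) / d1 - (x - c) / d2"
    "hyperbola_normal F1 F2 X \<bullet> e2 = y / d1 - y / d2"
    by (simp_all add: hyperbola_normal_def inner_diff_left sgn_coords coords_foci x_def y_def d1_def d2_def)
  have "a' * (x * (d2 - d1) + c * (d1 + d2)) = - 2 * (a^2 - c^2) * x"
    using d(3) sum a(2) by algebra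
  then have "x * (d2 - d1) + c * (d1 + d2) = - 2 * (a^2 - c^2) * x / a'"
    using a by (simp add: field_simps)
  moreover have "(x + c) / d1 - (x - c) / d2 = (x * (d2 - d1) + c * (d1 + d2)) / (d1 * d2)"
    using pos by (simp add: field_simps)
  ultimately have "(x + c) / d1 - (x - c) / d2 = (- 2 * (a^2 - c^2) * x / a') / (d1 * d2)"
    by (simp only:)
  also have "\<dots> = \<kappa> * (x / a'^2)"
    using a(1) pos unfolding \<kappa>_def by (simp add: field_simps power2_eq_square)
  finally have "(x + c) / d1 - (x - c) / d2 = \<kappa> * (x / a'^2)" .
  moreover have "y / d1 - y / d2 = \<kappa> * (y / (a^2 - c^2))"
  proof -
    have "y / d1 - y / d2 = - (y * (d1 - d2)) / (d1 * d2)" using pos by (simp add: field_simps)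
    then show ?thesis unfolding d(3) \<kappa>_def using b by simp
  qed
  ultimately show "\<exists>\<kappa>. \<kappa> \<noteq> 0 \<and> hyperbola_normal F1 F2 X \<bullet> e1 = \<kappa> * (xc X / a^2) \<and>
               hyperbola_normal F1 F2 X \<bullet> e2 = \<kappa> * (yc X / (a^2 - c^2))"
    using n \<open>\<kappa> \<noteq> 0\<close> a(2) unfolding x_def y_def by auto
qed

text \<open>The equation of the dual conic, for either sign of \<beta>. With \<open>m1\<close>,
  \<open>m2\<close> as in the proof, the normal \<open>(p, q)\<close> of the tangent at
  \<open>X\<close> is \<open>r\<close> times \<open>(m1, m2)\<close>, and
  \<open>\<alpha> * m1^2 + \<beta> * m2^2 = 1\<close>.\<close>

lemma tangency_condition:
  assumes line: "{Y. (Y - X) \<bullet> n = 0} = {Y. p * xc Y + q * yc Y = r}"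
    and n: "n \<bullet> e1 = \<kappa> * (xc X / \<alpha>)" "n \<bullet> e2 = \<kappa> * (yc X / \<beta>)" "\<kappa> \<noteq> 0"
    and nz: "\<alpha> \<noteq> 0" "\<beta> \<noteq> 0"
    and X: "(xc X)^2 / \<alpha> + (yc X)^2 / \<beta> = 1"
  shows "r^2 = \<alpha> * p^2 + \<beta> * q^2"
proof -
  define m1 m2 where "m1 = xc X / \<alpha>" and "m2 = yc X / \<beta>"
  have xy: "xc X = \<alpha> * m1" "yc X = \<beta> * m2" using nz by (simp_all add: m1_def m2_def)
  have "X \<in> {Y. (Y - X) \<bullet> n = 0}" by simp
  then have r: "p * xc X + q * yc X = r" unfolding line by simp
  \<comment> \<open>A direction vector of the line; \<open>X + w\<close> is a second point on
    it.\<close>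
  define w where "w = - q *\<^sub>R e1 + p *\<^sub>R e2"
  have w: "w \<bullet> e1 = - q" "w \<bullet> e2 = p"
    by (simp_all add: w_def inner_diff_left inner_add_left frame frame_swap)
  define Y where "Y = X + w"
  have "Y \<in> {Y. p * xc Y + q * yc Y = r}"
    using r by (simp add: Y_def coords_add w algebra_simps)
  then have "w \<bullet> n = 0" unfolding line[symmetric] by (simp add: Y_def)
  then have "\<kappa> * (- q * m1 + p * m2) = 0"
    unfolding inner_frame[of w n] w n m1_def m2_def by (simp add: algebra_simps)
  then have orth: "p * m2 = q * m1" using n(3) by simp
  have "\<alpha> * m1^2 + \<beta> * m2^2 = 1" using X nz unfolding m1_def m2_def by (simp add: power_divide power2_eq_square)
  then show ?thesis using r orth unfolding xy by algebra
qed

end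

lemma ex_focal_frame: "\<exists>e1 e2. focal_frame F1 F2 e1 e2 (dist F1 F2 / 2)"
proof -
  obtain e1 :: plane where e1: "norm e1 = 1" "F2 - F1 = dist F1 F2 *\<^sub>R e1"
  proof (cases "F1 = F2")
    case True
    then show ?thesis using that[of "axis 1 1"] by simp
  next
    case False
    then show ?thesis using that[of "sgn (F2 - F1)"]
      by (simp add: norm_sgn dist_norm norm_minus_commute sgn_div_norm)
  qed
  define e2 :: plane where "e2 = vector [- (e1 $ 2), e1 $ 1]"
  have "e2 \<bullet> e2 = e1 \<bullet> e1" "e1 \<bullet> e2 = 0"
    by (simp_all add: inner_vec_def sum_2 e2_def)
  then have "focal_frame F1 F2 e1 e2 (dist F1 F2 / 2)"
    using e1 by unfold_locales (simp_all add: norm_eq_1)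
  then show ?thesis by blast
qed

section \<open>The billiard\<close>

text \<open>Up to the factor \<open>h^2\<close>, the left sides are the product of the values of
  \<open>r\<close>, and minus the product of the values of \<open>p\<close>, before and after a
  reflection.\<close>

lemma billiard_sign_identities:
  fixes n1 n2 J K k a2 b2 h :: real
  assumes "a2 = b2 + k" "a2 * n1^2 + b2 * n2^2 = 1" "h = n1^2 + n2^2" "h = J^2 + K^2"
  shows "(J*k*n1*n2 + K) * (K - J*k*n1*n2) = h * (1 - J^2*(a2^2*n1^2+b2^2*n2^2))"
   "(J*n2 + K*n1) * (J*n2 - K*n1) = h * (J^2 - n1^2)"
  using assms by algebra+

locale billiard_frame = focal_frame +
  fixes s :: real and v :: "int \<Rightarrow> plane"
  assumes s: "c < s" and trajectory: "billiard_trajectory F1 F2 s v"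
begin

text \<open>The normal \<open>(p, q)\<close> is the direction of motion \<open>(q, - p)\<close>
  after a quarter turn, so each line is oriented by the motion.\<close>

definition p :: "int \<Rightarrow> real" where "p m = - (sgn (v (m + 1) - v m) \<bullet> e2)"
definition q :: "int \<Rightarrow> real" where "q m = sgn (v (m + 1) - v m) \<bullet> e1"
definition r :: "int \<Rightarrow> real" where "r m = p m * xc (v m) + q m * yc (v m)"

definition b2 :: real where "b2 = s^2 - c^2"
definition n1 :: "int \<Rightarrow> real" where "n1 m = xc (v m) / s^2"
definition n2 :: "int \<Rightarrow> real" where "n2 m = yc (v m) / b2"
definition h :: "int \<Rightarrow> real" where "h m = (n1 m)^2 + (n2 m)^2"
text \<open>Minus the component of the outgoing direction along \<open>(n1, n2)\<close>. Reflection
  flips this component, so the incoming direction has the value with the plus sign.\<close>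

definition Jout :: "int \<Rightarrow> real" where "Jout m = p m * n2 m - q m * n1 m"
definition K :: "int \<Rightarrow> real" where "K m = - (q m * n2 m + p m * n1 m)"

lemma axes_pos: "0 < s^2" "0 < b2"
  using c_nonneg s by (simp_all add: b2_def power_strict_mono)

lemma coords_vertex: "xc (v m) = s^2 * n1 m" "yc (v m) = b2 * n2 m"
  using axes_pos by (simp_all add: n1_def n2_def)

lemma vertex_on_ellipse: "s^2 * (n1 m)^2 + b2 * (n2 m)^2 = 1"
proof -
  have "v m \<in> ellipse F1 F2 s" using trajectory by (simp add: billiard_trajectory_def)
  moreover have "(a * x)^2 / a = a * x^2" if "a \<noteq> 0" for a x :: real
    using that by (simp add: power2_eq_square)
  ultimately show ?thesis
    using ellipse_equation(1)[of "v m" s] s axes_pos unfolding b2_def[symmetric] coords_vertex by simp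
qed

lemma h_pos: "0 < h m"
  using vertex_on_ellipse[of m] by (auto simp: h_def sum_power2_gt_zero_iff)

lemma vertices_distinct: "v m \<noteq> v (m + 1)"
  using trajectory by (simp add: billiard_trajectory_def)

lemma unit_normal: "(p m)^2 + (q m)^2 = 1"
  using norm_frame[of "sgn (v (m + 1) - v m)"] vertices_distinct[of m]
  by (simp add: p_def q_def norm_sgn)

lemma next_vertex:
  "xc (v (m + 1)) = xc (v m) + dist (v (m + 1)) (v m) * q m"
  "yc (v (m + 1)) = yc (v m) - dist (v (m + 1)) (v m) * p m"
  using vertices_distinct[of m] by (simp_all add: p_def q_def sgn_coords)

lemma r_next: "r m = p m * xc (v (m + 1)) + q m * yc (v (m + 1))"
  unfolding next_vertex r_def by (simp add: algebra_simps)

lemma reflection: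
  "h m * q m = h m * q (m - 1) - 2 * (q (m - 1) * n1 m - p (m - 1) * n2 m) * n1 m"
  "h m * p m = h m * p (m - 1) + 2 * (q (m - 1) * n1 m - p (m - 1) * n2 m) * n2 m"
proof -
  define n where "n = ellipse_normal F1 F2 (v m)"
  have "v m \<in> ellipse F1 F2 s" using trajectory by (simp add: billiard_trajectory_def)
  from ellipse_equation(2)[OF this s] obtain \<kappa> where \<kappa>: "\<kappa> > 0"
    "n \<bullet> e1 = \<kappa> * n1 m" "n \<bullet> e2 = \<kappa> * n2 m"
    unfolding n_def n1_def n2_def b2_def by blast
  have norm: "(norm n)^2 = \<kappa>^2 * h m"
    unfolding norm_frame \<kappa> h_def by (simp add: power_mult_distrib algebra_simps)
  moreover have "0 < \<kappa>^2 * h m" using \<kappa>(1) h_pos[of m] by simp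
  ultimately have "norm n \<noteq> 0" by auto
  define \<rho> where "\<rho> = \<kappa> / norm n"
  have "\<rho>^2 * h m = (\<kappa>^2 * h m) / (norm n)^2" by (simp add: \<rho>_def power_divide)
  then have \<rho>: "\<rho>^2 * h m = 1" using \<open>norm n \<noteq> 0\<close> unfolding norm[symmetric] by simp
  have nu: "sgn n \<bullet> e1 = \<rho> * n1 m" "sgn n \<bullet> e2 = \<rho> * n2 m"
    using \<kappa> by (simp_all add: sgn_div_norm \<rho>_def divide_inverse mult_ac)
  define u where "u = sgn (v (m - 1) - v m)"
  \<comment> \<open>\<open>mirror_directions\<close> looks back at the previous vertex, against the
    direction of motion.\<close>
  have "u = - sgn (v m - v (m - 1))" unfolding u_def by (metis minus_diff_eq sgn_minus)
  then have u: "u \<bullet> e1 = - q (m - 1)" "u \<bullet> e2 = p (m - 1)"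
    by (simp_all add: p_def q_def)
  have "sgn (v (m + 1) - v m) = (2 * (u \<bullet> sgn n)) *\<^sub>R sgn n - u"
    using trajectory unfolding billiard_trajectory_def mirror_directions_def u_def n_def by blast
  then have qp: "q m = 2 * (u \<bullet> sgn n) * (\<rho> * n1 m) + q (m - 1)" "p m = - (2 * (u \<bullet> sgn n) * (\<rho> * n2 m)) + p (m - 1)"
    unfolding p_def[of m] q_def[of m] by (simp_all add: inner_diff_left nu u)
  define W where "W = q (m - 1) * n1 m - p (m - 1) * n2 m"
  have "u \<bullet> sgn n = - \<rho> * W"
    unfolding inner_frame[of u "sgn n"] u nu W_def by (simp add: algebra_simps)
  then have "h m * q m = h m * q (m - 1) - 2 * (\<rho>^2 * h m) * W * n1 m"
    "h m * p m = h m * p (m - 1) + 2 * (\<rho>^2 * h m) * W * n2 m"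
    unfolding qp by (simp_all add: algebra_simps power2_eq_square)
  then show "h m * q m = h m * q (m - 1) - 2 * (q (m - 1) * n1 m - p (m - 1) * n2 m) * n1 m"
    "h m * p m = h m * p (m - 1) + 2 * (q (m - 1) * n1 m - p (m - 1) * n2 m) * n2 m"
    unfolding \<rho> W_def by simp_all
qed

lemma Jout_incoming: "q (m - 1) * n1 m - p (m - 1) * n2 m = Jout m"
  and K_incoming: "- (q (m - 1) * n2 m + p (m - 1) * n1 m) = K m"
proof -
  have "h m * (q (m - 1) * n1 m - p (m - 1) * n2 m) = h m * Jout m"
    using reflection[of m] h_def[of m] unfolding Jout_def by algebra
  then show "q (m - 1) * n1 m - p (m - 1) * n2 m = Jout m" using h_pos[of m] by simp
  have "h m * (- (q (m - 1) * n2 m + p (m - 1) * n1 m)) = h m * K m"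
    using reflection[of m] h_def[of m] unfolding K_def by algebra
  then show "- (q (m - 1) * n2 m + p (m - 1) * n1 m) = K m" using h_pos[of m] by simp
qed

text \<open>For points \<open>v\<close>, \<open>v'\<close> of the ellipse with gradients
  \<open>n\<close>, \<open>n'\<close>, the product \<open>(v' - v) \<bullet> (n + n')\<close>
  vanishes: \<open>v \<bullet> n = v' \<bullet> n' = 1\<close>, and the mixed terms agree by
  symmetry of the quadratic form.\<close>

lemma Joachimsthal: "Jout m = Jout 0"
proof (rule int_shift_invariant_const[where f = Jout])
  fix m
  define \<tau> where "\<tau> = dist (v (m + 1)) (v m)"
  have \<tau>: "\<tau> \<noteq> 0" using vertices_distinct[of m] by (simp add: \<tau>_def)
  have "s^2 * n1 (m + 1) = s^2 * n1 m + \<tau> * q m" "b2 * n2 (m + 1) = b2 * n2 m - \<tau> * p m"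
    using next_vertex[of m] by (simp_all add: coords_vertex \<tau>_def)
  then have "\<tau> * (q m * (n1 m + n1 (m + 1)) - p m * (n2 m + n2 (m + 1))) = 0"
    using vertex_on_ellipse[of m] vertex_on_ellipse[of "m + 1"] by algebra
  then have "q m * (n1 m + n1 (m + 1)) - p m * (n2 m + n2 (m + 1)) = 0"
    using \<tau> by simp
  moreover have "q m * n1 (m + 1) - p m * n2 (m + 1) = Jout (m + 1)"
    using Jout_incoming[of "m + 1"] by simp
  ultimately show "Jout (m + 1) = Jout m"
    unfolding Jout_def[of m] by (simp only: ring_distribs)
qed

section \<open>The reflection as a shift of the curve\<close>

definition J :: real where "J = Jout 0"
text \<open>The squared focal semi-axis of the caustic, as found in the first of the
  \<open>vertex_identities\<close>.\<close>

definition A :: real where "A = s^2 * (1 - b2 * J^2)"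
definition w :: real where "w = 1 + c^2 * J^2"

lemma w_pos: "0 < w" by (simp add: w_def add_pos_nonneg)

lemma outgoing_line:
  "p m * h m = J * n2 m - K m * n1 m" "q m * h m = - (J * n1 m + K m * n2 m)"
  "r m * h m = J * c^2 * n1 m * n2 m - K m"
proof -
  have J: "p m * n2 m - q m * n1 m = J" using Joachimsthal[of m] by (simp add: J_def Jout_def)
  have K: "- (q m * n2 m + p m * n1 m) = K m" by (simp add: K_def)
  show p: "p m * h m = J * n2 m - K m * n1 m" "q m * h m = - (J * n1 m + K m * n2 m)"
    unfolding J[symmetric] K_def h_def by algebra+
  have "r m = p m * (s^2 * n1 m) + q m * (b2 * n2 m)" by (simp add: r_def coords_vertex)
  moreover have "b2 = s^2 - c^2" by (rule b2_def)
  ultimately show "r m * h m = J * c^2 * n1 m * n2 m - K m"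
    using p vertex_on_ellipse[of m] by algebra
qed

lemma incoming_line:
  "p (m - 1) * h m = - (J * n2 m + K m * n1 m)" "q (m - 1) * h m = J * n1 m - K m * n2 m"
  "r (m - 1) * h m = - (J * c^2 * n1 m * n2 m + K m)"
proof -
  have J: "q (m - 1) * n1 m - p (m - 1) * n2 m = J"
    using Joachimsthal[of m] by (simp add: J_def Jout_incoming)
  show p: "p (m - 1) * h m = - (J * n2 m + K m * n1 m)" "q (m - 1) * h m = J * n1 m - K m * n2 m"
    unfolding J[symmetric] K_incoming[of m, symmetric] h_def by algebra+
  have "r (m - 1) = p (m - 1) * (s^2 * n1 m) + q (m - 1) * (b2 * n2 m)"
    using r_next[of "m - 1"] by (simp add: coords_vertex)
  moreover have "b2 = s^2 - c^2" by (rule b2_def)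
  ultimately show "r (m - 1) * h m = - (J * c^2 * n1 m * n2 m + K m)"
    using p vertex_on_ellipse[of m] by algebra
qed

lemma h_eq: "h m = J^2 + (K m)^2"
proof -
  have "h m = (Jout m)^2 + (K m)^2"
    using unit_normal[of m] unfolding Jout_def K_def h_def by algebra
  then show ?thesis by (simp add: Joachimsthal[of m] J_def)
qed

lemma lines_on_curve: "on_curve A (c^2) (p m) (q m) (r m)"
proof -
  have 1: "s^2 = b2 + c^2" by (simp add: b2_def)
  \<comment> \<open>Line \<open>m\<close> is the incoming line at vertex
    \<open>m + 1\<close>.\<close>
  have "(r m * h (m + 1))^2 = A * (h (m + 1))^2 - c^2 * (q m * h (m + 1))^2"
    using vertex_identities(1)[OF 1 vertex_on_ellipse h_def h_eq, of "m + 1"] incoming_line[of "m + 1"]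
    unfolding A_def by simp
  then have "(h (m + 1))^2 * (r m)^2 = (h (m + 1))^2 * (A - c^2 * (q m)^2)"
    by (simp add: power_mult_distrib algebra_simps)
  then have "(r m)^2 = A - c^2 * (q m)^2" using h_pos[of "m + 1"] by simp
  then show ?thesis using unit_normal[of m] by (simp add: on_curve_def)
qed

text \<open>The shift is read off from the \<open>vertex_identities\<close>; it involves only
  \<open>s\<close>, \<open>c\<close> and \<open>J\<close>, hence is the same at every
  vertex.\<close>

definition t :: real where "t = - 2 * J / w"
definition e :: real where "e = (1 - c^2 * J^2) / w"
definition g :: real where "g = (1 - (s^2 + b2) * J^2) / w"

lemma translation_scaled: "w * t = - 2 * J" "w * e = 1 - c^2 * J^2" "w * g = 1 - (s^2 + b2) * J^2"
  using w_pos by (simp_all add: t_def e_def g_def)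

lemma translation_on_curve: "g^2 = 1 - A * t^2" "e^2 = 1 - c^2 * t^2"
proof -
  have "w^2 * g^2 = w^2 * (1 - A * t^2)"
  proof -
    have "(w * g)^2 = w^2 - A * (w * t)^2"
      unfolding translation_scaled unfolding A_def w_def b2_def by algebra
    then show ?thesis by (simp add: power_mult_distrib algebra_simps)
  qed
  then show "g^2 = 1 - A * t^2" using w_pos by simp
  have "w^2 * e^2 = w^2 * (1 - c^2 * t^2)"
  proof -
    have "(w * e)^2 = w^2 - c^2 * (w * t)^2"
      unfolding translation_scaled unfolding w_def by algebra
    then show ?thesis by (simp add: power_mult_distrib algebra_simps)
  qed
  then show "e^2 = 1 - c^2 * t^2" using w_pos by simp
qed

text \<open>Both \<open>c^2 * t^2 = 1 - e^2\<close> and \<open>q^2\<close> are at most 1, so a zero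
  forces \<open>e = 0\<close> and \<open>q^2 = 1\<close>. The latter gives
  \<open>c^2 \<le> A\<close>, but \<open>e = 0\<close> means \<open>c^2 * J^2 = 1\<close> and hence
  \<open>A = c^2 - b2^2 * J^2 < c^2\<close>.\<close>

lemma translation_denominator: "1 - c^2 * t^2 * (q m)^2 \<noteq> 0"
proof
  assume "1 - c^2 * t^2 * (q m)^2 = 0"
  then have eq: "c^2 * t^2 * (q m)^2 = 1" by simp
  have q: "(q m)^2 \<le> 1" using curve_nonneg(1)[OF lines_on_curve] by simp
  have "0 \<le> c^2 * t^2" by simp
  have "c^2 * t^2 \<le> 1" using translation_on_curve(2) by (metis diff_ge_0_iff_ge zero_le_power2)
  moreover have "1 \<le> c^2 * t^2" using mult_left_le[OF q \<open>0 \<le> c^2 * t^2\<close>] eq by simp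
  ultimately have ct: "c^2 * t^2 = 1" by simp
  then have "(q m)^2 = 1" using eq by simp
  then have "c^2 \<le> A" using curve_nonneg(2)[OF lines_on_curve[of m]] by simp
  have "e = 0" using translation_on_curve(2) ct by simp
  then have cJ: "c^2 * J^2 = 1" using translation_scaled(2) by simp
  have s2: "s^2 = b2 + c^2" by (simp add: b2_def)
  have "A = s^2 - b2 * (s^2 * J^2)" by (simp add: A_def algebra_simps)
  moreover have "s^2 * J^2 = b2 * J^2 + 1" unfolding s2 by (simp add: distrib_right cJ)
  ultimately have "A = c^2 - b2 * (b2 * J^2)" by (simp add: s2 algebra_simps)
  moreover have "J \<noteq> 0" using cJ by auto
  then have "0 < b2 * (b2 * J^2)" using axes_pos by simp
  ultimately show False using \<open>c^2 \<le> A\<close> by simp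
qed

lemma lines_shifted: "shifted (c^2) g t e (p (m - 1)) (q (m - 1)) (r (m - 1)) (p m) (q m) (r m)"
proof -
  define pi qi ri po qo ro where "pi = p (m - 1)" and "qi = q (m - 1)" and "ri = r (m - 1)"
    and "po = p m" and "qo = q m" and "ro = r m"
  define H where "H = h m"
  have H: "H \<noteq> 0" using h_pos[of m] by (simp add: H_def)
  have 1: "s^2 = b2 + c^2" by (simp add: b2_def)
  note ids = vertex_identities(2-4)[OF 1 vertex_on_ellipse h_def h_eq, of m,
      folded incoming_line outgoing_line translation_scaled w_def,
      folded pi_def qi_def ri_def po_def qo_def ro_def H_def]
  have J: "4 * c^2 * J^2 = c^2 * (w * t)^2" "2 * J = - (w * t)" "2 * c^2 * J = - (c^2 * (w * t))"
    by (simp_all add: translation_scaled power_mult_distrib)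
  \<comment> \<open>The three identities, homogeneous in the scaled lines, share the factor
    \<open>H^3 * w^2\<close>.\<close>
  have "H^3 * w^2 * ((1 - c^2 * t^2 * qi^2) * po) = H^3 * w^2 * (pi * g - qi * ri * t * e)"
    "H^3 * w^2 * ((1 - c^2 * t^2 * qi^2) * qo) = H^3 * w^2 * (qi * g * e + pi * ri * t)"
    "H^3 * w^2 * ((1 - c^2 * t^2 * qi^2) * ro) = H^3 * w^2 * (ri * e - c^2 * t * g * pi * qi)"
    using ids unfolding J by (simp_all add: algebra_simps power2_eq_square power3_eq_cube)
  then have "(1 - c^2 * t^2 * qi^2) * po = pi * g - qi * ri * t * e"
    "(1 - c^2 * t^2 * qi^2) * qo = qi * g * e + pi * ri * t"
    "(1 - c^2 * t^2 * qi^2) * ro = ri * e - c^2 * t * g * pi * qi"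
    using H w_pos by simp_all
  then show ?thesis
    using translation_denominator[of "m - 1"]
    by (simp add: shifted_def pi_def qi_def ri_def po_def qo_def ro_def)
qed

section \<open>Signs of consecutive lines\<close>

lemma A_compare: "c^2 < A \<longleftrightarrow> s^2 * J^2 < 1" "A < c^2 \<longleftrightarrow> 1 < s^2 * J^2"
proof -
  have eq: "A - c^2 = b2 * (1 - s^2 * J^2)"
    by (simp add: A_def b2_def algebra_simps)
  show "c^2 < A \<longleftrightarrow> s^2 * J^2 < 1" "A < c^2 \<longleftrightarrow> 1 < s^2 * J^2"
    using axes_pos(2) zero_less_mult_iff[of b2 "1 - s^2 * J^2"] mult_less_0_iff[of b2 "1 - s^2 * J^2"]
    unfolding eq[symmetric] by auto
qed

lemma r_sign:
  assumes "c^2 < A"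
  shows "0 < r (m - 1) * r m"
proof -
  have 1: "s^2 = b2 + c^2" by (simp add: b2_def)
  have "b2 * (n2 m)^2 * b2 \<le> b2 * (n2 m)^2 * s^2"
    using axes_pos 1 by (intro mult_left_mono) simp_all
  \<comment> \<open>The vertex is at distance at most \<open>s\<close> from the centre.\<close>
  then have "(s^2)^2 * (n1 m)^2 + b2^2 * (n2 m)^2 \<le> s^2 * (s^2 * (n1 m)^2 + b2 * (n2 m)^2)"
    by (simp add: algebra_simps power2_eq_square)
  also have "\<dots> = s^2" by (simp add: vertex_on_ellipse)
  finally have "J^2 * ((s^2)^2 * (n1 m)^2 + b2^2 * (n2 m)^2) \<le> J^2 * s^2"
    by (intro mult_left_mono) simp_all
  also have "\<dots> < 1" using assms A_compare(1) by (simp add: mult.commute)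
  finally have "0 < h m * (1 - J^2 * ((s^2)^2 * (n1 m)^2 + b2^2 * (n2 m)^2))"
    using h_pos[of m] by simp
  also have "\<dots> = (r (m - 1) * h m) * (r m * h m)"
    using billiard_sign_identities(1)[OF 1 vertex_on_ellipse h_def h_eq, of m]
    unfolding incoming_line outgoing_line by (simp add: algebra_simps)
  also have "\<dots> = (r (m - 1) * r m) * (h m)^2" by (simp add: power2_eq_square)
  finally show ?thesis using h_pos[of m] by (simp add: zero_less_mult_iff)
qed

lemma p_sign:
  assumes "A < c^2"
  shows "p (m - 1) * p m < 0"
proof -
  have 1: "s^2 = b2 + c^2" by (simp add: b2_def)
  \<comment> \<open>The first coordinate of a vertex is at most \<open>s\<close> in absolute
    value.\<close>
  have "s^2 * (n1 m)^2 \<le> 1"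
    using vertex_on_ellipse[of m] axes_pos by (smt (verit) mult_nonneg_nonneg zero_le_power2)
  also have "\<dots> < s^2 * J^2" using assms A_compare(2) by simp
  finally have "(n1 m)^2 < J^2" using axes_pos(1) by (simp only: mult_less_cancel_left_pos)
  then have "0 < h m * (J^2 - (n1 m)^2)" using h_pos[of m] by simp
  also have "\<dots> = - ((p (m - 1) * h m) * (p m * h m))"
    using billiard_sign_identities(2)[OF 1 vertex_on_ellipse h_def h_eq, of m]
    unfolding incoming_line outgoing_line by (simp add: algebra_simps)
  also have "\<dots> = - ((p (m - 1) * p m) * (h m)^2)" by (simp add: power2_eq_square)
  finally show ?thesis using h_pos[of m] by (simp add: zero_less_mult_iff mult_less_0_iff)
qed

sublocale line_chain A "c^2" g t e p q r
proof
  show "0 \<le> c^2" by simp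
  show "on_curve A (c^2) (p i) (q i) (r i)" for i by (rule lines_on_curve)
  show "g^2 = 1 - A * t^2" "e^2 = 1 - c^2 * t^2" by (fact translation_on_curve)+
  show "e = 1" if "c^2 = 0" using that unfolding e_def w_def by simp
  show "shifted (c^2) g t e (p i) (q i) (r i) (p (i + 1)) (q (i + 1)) (r (i + 1))" for i
    using lines_shifted[of "i + 1"] by simp
  show "0 < r i * r (i + 1)" if "c^2 < A" for i using r_sign[OF that, of "i + 1"] by simp
  show "p i * p (i + 1) < 0" if "A < c^2" for i using p_sign[OF that, of "i + 1"] by simp
qed

section \<open>Side lines and their intersection points\<close>

lemma side_line_eq: "side_line v m = {X. p m * xc X + q m * yc X = r m}"
proof -
  define \<tau> where "\<tau> = dist (v (m + 1)) (v m)"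
  have \<tau>: "\<tau> \<noteq> 0" using vertices_distinct[of m] by (simp add: \<tau>_def)
  have dir: "(v (m + 1) - v m) \<bullet> e1 = \<tau> * q m" "(v (m + 1) - v m) \<bullet> e2 = - (\<tau> * p m)"
    using next_vertex[of m] by (simp_all add: coords_diff \<tau>_def)
  have "X \<in> side_line v m \<longleftrightarrow> p m * xc X + q m * yc X = r m" for X
  proof
    assume "X \<in> side_line v m"
    then obtain l where X: "X = v m + l *\<^sub>R (v (m + 1) - v m)"
      unfolding side_line_def affine_hull_2_alt by blast
    show "p m * xc X + q m * yc X = r m"
      unfolding X coords_add inner_scaleR_left dir r_def by (simp add: algebra_simps)
  next
    assume X: "p m * xc X + q m * yc X = r m"
    \<comment> \<open>The component of \<open>X - v m\<close> along the unit direction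
      \<open>(q, - p)\<close>, in units of the length of the segment.\<close>
    define l where "l = (q m * (xc X - xc (v m)) - p m * (yc X - yc (v m))) / \<tau>"
    have l: "l * \<tau> = q m * (xc X - xc (v m)) - p m * (yc X - yc (v m))"
      using \<tau> by (simp add: l_def)
    have orth: "p m * (xc X - xc (v m)) + q m * (yc X - yc (v m)) = 0"
      using X by (simp add: r_def algebra_simps)
    have "xc X - xc (v m) = (l * \<tau>) * q m" "yc X - yc (v m) = - ((l * \<tau>) * p m)"
      unfolding l using orth unit_normal[of m] by algebra+
    then have "X = v m + l *\<^sub>R (v (m + 1) - v m)"
      unfolding coords_eq coords_add inner_scaleR_left dir by simp
    then show "X \<in> side_line v m"
      unfolding side_line_def affine_hull_2_alt by blast
  qed
  then show ?thesis by blast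
qed

lemma crossing_side_lines:
  assumes "X \<in> crossing (side_line v i) (side_line v j)"
  shows "p i * xc X + q i * yc X = r i" "p j * xc X + q j * yc X = r j" "p i * q j \<noteq> p j * q i"
proof -
  have int: "side_line v i \<inter> side_line v j = {X}" using assms by (simp add: crossing_def)
  then have "X \<in> side_line v i" "X \<in> side_line v j" by blast+
  then show X: "p i * xc X + q i * yc X = r i" "p j * xc X + q j * yc X = r j"
    by (simp_all add: side_line_eq)
  show "p i * q j \<noteq> p j * q i"
  proof
    assume par: "p i * q j = p j * q i"
    \<comment> \<open>A common direction of the parallel lines: it leads from \<open>X\<close> to a
      second common point.\<close>
    define d where "d = (- q i) *\<^sub>R e1 + p i *\<^sub>R e2"
    have d: "d \<bullet> e1 = - q i" "d \<bullet> e2 = p i"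
      by (simp_all add: d_def inner_add_left inner_diff_left frame frame_swap)
    have "X + d \<in> side_line v i \<inter> side_line v j"
      using X par by (simp add: side_line_eq coords_add d algebra_simps)
    then have "X + d = X" using int by blast
    then have "q i = 0" "p i = 0" using d by auto
    then show False using unit_normal[of i] by simp
  qed
qed

end

section \<open>The sets of intersection points for each type of caustic\<close>

context billiard_frame
begin

abbreviation axis2_same :: "int \<Rightarrow> int \<Rightarrow> real" where
  "axis2_same i j \<equiv> axis2 A (c^2) (p i) (q i) (r i) (p j) (q j) (r j)"
abbreviation axis2_opposite :: "int \<Rightarrow> int \<Rightarrow> real" where
  "axis2_opposite i j \<equiv> axis2 A (c^2) (p i) (q i) (r i) (- p j) (- q j) (- r j)"

lemma opposite_on_curve: "on_curve A (c^2) (- p i) (- q i) (- r i)"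
  using lines_on_curve[of i] by (simp add: on_curve_def)

lemma crossing_roots:
  assumes "X \<in> crossing (side_line v i) (side_line v j)"
  shows "axis2_same i j + axis2_opposite i j = (xc X)^2 + (yc X)^2 + c^2"
    and "axis2_same i j * axis2_opposite i j = c^2 * (xc X)^2"
    and "0 < 1 + p i * p j + q i * q j" "0 < 1 + p i * (- p j) + q i * (- q j)"
  using crossing_axes[OF lines_on_curve lines_on_curve crossing_side_lines[OF assms]] by simp_all

lemma P_set_roots:
  "\<exists>\<alpha>. \<forall>X\<in>P_set v m.
    \<exists>i j. i - j = m \<and> X \<in> crossing (side_line v j) (side_line v i) \<and> axis2_same j i = \<alpha>"
proof -
  obtain \<alpha> where \<alpha>: "\<And>i j. i - j = m \<Longrightarrow> p j * q i \<noteq> p i * q j \<Longrightarrow> axis2_same j i = \<alpha>"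
    using axis2_P[of m] by blast
  show ?thesis
  proof (rule exI[of _ \<alpha>], rule ballI)
    fix X assume "X \<in> P_set v m"
    then obtain i j where ij: "i - j = m" and "X \<in> crossing (side_line v i) (side_line v j)"
      unfolding P_set_def by auto
    then have "X \<in> crossing (side_line v j) (side_line v i)"
      by (simp add: crossing_def Int_commute)
    with ij show "\<exists>i j. i - j = m \<and> X \<in> crossing (side_line v j) (side_line v i) \<and> axis2_same j i = \<alpha>"
      using \<alpha> crossing_side_lines(3) by blast
  qed
qed

lemma Q_set_roots:
  "\<exists>\<alpha>. \<forall>X\<in>Q_set v m.
    \<exists>i j. i + j = m \<and> X \<in> crossing (side_line v i) (side_line v j) \<and> axis2_opposite i j = \<alpha>"
proof -
  obtain \<alpha> where \<alpha>: "\<And>i j. i + j = m \<Longrightarrow> p i * q j \<noteq> p j * q i \<Longrightarrow> axis2_opposite i j = \<alpha>"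
    using axis2_Q[of m] by blast
  show ?thesis
  proof (rule exI[of _ \<alpha>], rule ballI)
    fix X assume "X \<in> Q_set v m"
    then obtain i j where "i + j = m" "X \<in> crossing (side_line v i) (side_line v j)"
      unfolding Q_set_def by auto
    then show "\<exists>i j. i + j = m \<and> X \<in> crossing (side_line v i) (side_line v j) \<and> axis2_opposite i j = \<alpha>"
      using \<alpha> crossing_side_lines(3) by blast
  qed
qed

lemma axis2_same_ge:
  assumes "c^2 < A" "X \<in> crossing (side_line v i) (side_line v j)"
  shows "A \<le> axis2_same i j"
  using assms r_same_sign crossing_roots(3) by (intro axis2_ge lines_on_curve) auto

lemma axis2_same_le:
  assumes "A < c^2" "X \<in> crossing (side_line v i) (side_line v j)" "even (i - j)"
  shows "axis2_same i j \<le> A"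
  using assms p_alternating(1) crossing_roots(3) by (intro axis2_le lines_on_curve) auto

lemma axis2_opposite_le:
  assumes "A < c^2" "X \<in> crossing (side_line v i) (side_line v j)" "odd (i - j)"
  shows "axis2_opposite i j \<le> A"
proof -
  \<comment> \<open>Reversing line \<open>j\<close> gives the two lines equal signs of
    \<open>p\<close>.\<close>
  have "p i * p j < 0"
    using p_alternating[OF assms(1)] assms(3) by (metis linorder_neqE_linordered_idom mult_eq_0_iff)
  then show ?thesis
    using assms crossing_roots(4) by (intro axis2_le lines_on_curve opposite_on_curve) auto
qed

text \<open>All \<open>r\<close> have one sign, so \<alpha> is at least \<open>A > c^2\<close>; no
  limiting ellipse can occur.\<close>

lemma P_set_elliptic:
  assumes "c^2 < A"
  shows "\<exists>C. confocal_ellipse F1 F2 C \<and> P_set v m \<subseteq> C"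
proof -
  obtain \<alpha> where \<alpha>: "\<forall>X\<in>P_set v m.
      \<exists>i j. i - j = m \<and> X \<in> crossing (side_line v j) (side_line v i) \<and> axis2_same j i = \<alpha>"
    using P_set_roots[of m] by blast
  show ?thesis
  proof (rule covered_by_ellipse[of _ \<alpha>])
    fix X assume "X \<in> P_set v m"
    then obtain i j where X: "X \<in> crossing (side_line v j) (side_line v i)" "axis2_same j i = \<alpha>"
      using \<alpha> by blast
    show "c^2 < \<alpha> \<and> (\<exists>\<beta>. \<alpha> + \<beta> = (xc X)^2 + (yc X)^2 + c^2 \<and> \<alpha> * \<beta> = c^2 * (xc X)^2)"
      using axis2_same_ge[OF assms X(1)] crossing_roots(1,2)[OF X(1)] assms unfolding X(2) by auto
  qed
qed

text \<open>On a circle, \<open>p + i q\<close> is rotated by a fixed angle at each step, so the product of the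
  normals of the lines \<open>i\<close> and \<open>j\<close> as complex numbers depends on \<open>i + j\<close> only. Its square roots
  give the direction in which the intersection point is seen from the centre.\<close>

lemma Q_set_circle:
  assumes "c = 0"
  shows "\<exists>C. hyperbola_or_limit F1 F2 C \<and> Q_set v m \<subseteq> C"
proof -
  have F: "F2 = F1" using foci assms by simp
  have "e = 1" using translation(3) assms by simp
  then have step: "p (i + 1) = p i * g - q i * r i * t" "q (i + 1) = q i * g + p i * r i * t"
      "r (i + 1) = r i" for i
    using shifted[of i] assms by (simp_all add: shifted_def)
  have r: "r i = r 0" for i
    by (rule int_shift_invariant_const[where f = r], rule step(3))
  define C where "C i = p i * p (m - i) - q i * q (m - i)" for i
  define S where "S i = p i * q (m - i) + q i * p (m - i)" for i
  have "C (i + 1) = C i" "S (i + 1) = S i" for i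
  proof -
    define j where "j = m - (i + 1)"
    have back_step: "p (m - i) = p j * g - q j * r 0 * t" "q (m - i) = q j * g + p j * r 0 * t"
      using step(1,2)[of j] r[of j] by (simp_all add: j_def)
    show "C (i + 1) = C i" "S (i + 1) = S i"
      unfolding C_def S_def step(1,2) r[of i] j_def[symmetric] back_step by (simp_all add: algebra_simps)
  qed
  then have CS: "C i = C 0" "S i = S 0" for i
    using int_shift_invariant_const[where f = C and i = i and j = 0]
      int_shift_invariant_const[where f = S and i = i and j = 0] by auto
  have "(C 0)^2 + (S 0)^2 = 1"
    using unit_normal[of 0] unit_normal[of m] unfolding C_def S_def diff_0_right by algebra
  then obtain \<theta> where \<theta>: "C 0 = cos \<theta>" "S 0 = sin \<theta>" by (metis sincos_total_2pi)
  \<comment> \<open>A square root of the complex number \<open>C 0 + i S 0\<close>, by halving the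
    angle.\<close>
  define z1 z2 where "z1 = cos (\<theta> / 2)" and "z2 = sin (\<theta> / 2)"
  have z: "z1^2 + z2^2 = 1" "C 0 = z1^2 - z2^2" "S 0 = 2 * z1 * z2"
    using cos_double[of "\<theta> / 2"] sin_double[of "\<theta> / 2"] by (simp_all add: z1_def z2_def \<theta>)
  define d where "d = z1 *\<^sub>R e1 + z2 *\<^sub>R e2"
  have d: "d \<bullet> e1 = z1" "d \<bullet> e2 = z2" by (simp_all add: d_def inner_add_left frame frame_swap)
  have "d \<noteq> 0" using d z(1) by auto
  have "limit_hyperbola F1 F2 (affine hull {F1, F1 + d})"
    unfolding limit_hyperbola_def using F \<open>d \<noteq> 0\<close> by (auto intro!: exI[of _ "F1 + d"])
  moreover have "Q_set v m \<subseteq> affine hull {F1, F1 + d}"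
  proof
    fix X assume "X \<in> Q_set v m"
    then obtain i where X: "X \<in> crossing (side_line v i) (side_line v (m - i))"
      unfolding Q_set_def by (auto simp: algebra_simps) (metis add_diff_cancel_left')
    define x y p1 q1 p2 q2 where "x = xc X" and "y = yc X" and "p1 = p i" and "q1 = q i"
      and "p2 = p (m - i)" and "q2 = q (m - i)"
    have lines: "p1 * x + q1 * y = r 0" "p2 * x + q2 * y = r 0" "p1 * q2 - p2 * q1 \<noteq> 0"
      using crossing_side_lines[OF X] r[of i] r[of "m - i"]
      by (simp_all add: x_def y_def p1_def q1_def p2_def q2_def)
    have unit: "p1^2 + q1^2 = 1" "p2^2 + q2^2 = 1"
      using unit_normal by (simp_all add: p1_def q1_def p2_def q2_def)
    have prod: "p1 * p2 - q1 * q2 = z1^2 - z2^2" "p1 * q2 + q1 * p2 = 2 * z1 * z2"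
      using CS[of i] z by (simp_all add: C_def S_def p1_def q1_def p2_def q2_def)
    define D where "D = p1 * q2 - p2 * q1"
    have xy: "D * x = r 0 * (q2 - q1)" "D * y = r 0 * (p1 - p2)"
    proof -
      have "D * x = q2 * (p1 * x + q1 * y) - q1 * (p2 * x + q2 * y)"
        "D * y = p1 * (p2 * x + q2 * y) - p2 * (p1 * x + q1 * y)"
        by (simp_all add: D_def algebra_simps)
      then show "D * x = r 0 * (q2 - q1)" "D * y = r 0 * (p1 - p2)"
        unfolding lines(1,2) by (simp_all add: algebra_simps)
    qed
    \<comment> \<open>The difference of two unit complex numbers is orthogonal to a square root of
      their product.\<close>
    have "((q2 - q1) * z2 - (p1 - p2) * z1)^2 = 0"
      using unit prod z(1) by algebra
    then have "(q2 - q1) * z2 - (p1 - p2) * z1 = 0" by simp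
    then have "D * (x * z2 - y * z1) = 0" using xy by algebra
    then have col: "x * z2 = y * z1" using lines(3) by (simp add: D_def)
    have "x = (x * z1 + y * z2) * z1" "y = (x * z1 + y * z2) * z2"
      using col z(1) by algebra+
    then have "X = F1 + (x * z1 + y * z2) *\<^sub>R (F1 + d - F1)"
      unfolding coords_eq coords_add by (simp add: coords_foci assms d x_def y_def)
    then show "X \<in> affine hull {F1, F1 + d}" unfolding affine_hull_2_alt by blast
  qed
  ultimately show ?thesis unfolding hyperbola_or_limit_def by blast
qed

lemma Q_set_elliptic:
  assumes "c^2 < A"
  shows "\<exists>C. hyperbola_or_limit F1 F2 C \<and> Q_set v m \<subseteq> C"
proof (cases "c = 0")
  case False
  then have "0 < c" using c_nonneg by simp
  obtain \<alpha> where \<alpha>: "\<forall>X\<in>Q_set v m.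
      \<exists>i j. i + j = m \<and> X \<in> crossing (side_line v i) (side_line v j) \<and> axis2_opposite i j = \<alpha>"
    using Q_set_roots[of m] by blast
  show ?thesis
  proof (rule covered_by_hyperbola_or_limit[of _ \<alpha>])
    fix X assume "X \<in> Q_set v m"
    then obtain i j where X: "X \<in> crossing (side_line v i) (side_line v j)" "axis2_opposite i j = \<alpha>"
      using \<alpha> by blast
    \<comment> \<open>The root for equal orientations is at least \<open>A > c^2\<close>, hence the
      elliptic one.\<close>
    show "\<exists>\<beta>. \<alpha> + \<beta> = (xc X)^2 + (yc X)^2 + c^2 \<and> \<alpha> * \<beta> = c^2 * (xc X)^2 \<and> (\<alpha> < c^2 \<or> c^2 < \<beta>)"
      using axis2_same_ge[OF assms X(1)] crossing_roots(1,2)[OF X(1)] assms unfolding X(2)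
      by (intro exI[of _ "axis2_same i j"]) (auto simp: algebra_simps)
  qed (use \<open>0 < c\<close> in simp)
qed (rule Q_set_circle)

lemma c_pos_if_hyperbolic:
  assumes "A < c^2"
  shows "0 < c"
  using assms curve_nonneg(3)[OF lines_on_curve[of 0]] c_nonneg by (cases "c = 0") auto

text \<open>The signs of \<open>p\<close> alternate. For odd \<open>m\<close> the bound
  \<open>A < c^2\<close> therefore applies to the root with one line reversed, which leaves the
  elliptic type for \<alpha>; this agrees with consecutive lines meeting on the billiard ellipse.
  For even \<open>m\<close> it applies to \<alpha> itself.\<close>

lemma P_set_hyperbolic:
  assumes "A < c^2"
  shows "odd m \<Longrightarrow> \<exists>C. ellipse_or_limit F1 F2 C \<and> P_set v m \<subseteq> C"
    and "even m \<Longrightarrow> \<exists>C. hyperbola_or_limit F1 F2 C \<and> P_set v m \<subseteq> C"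
proof -
  obtain \<alpha> where \<alpha>: "\<forall>X\<in>P_set v m.
      \<exists>i j. i - j = m \<and> X \<in> crossing (side_line v j) (side_line v i) \<and> axis2_same j i = \<alpha>"
    using P_set_roots[of m] by blast
  show "\<exists>C. ellipse_or_limit F1 F2 C \<and> P_set v m \<subseteq> C" if "odd m"
  proof (rule covered_by_ellipse_or_limit[of _ \<alpha>])
    fix X assume "X \<in> P_set v m"
    then obtain i j where X: "i - j = m" "X \<in> crossing (side_line v j) (side_line v i)" "axis2_same j i = \<alpha>"
      using \<alpha> by blast
    have "odd (j - i)" using that X(1) by auto
    then show "\<exists>\<beta>. \<alpha> + \<beta> = (xc X)^2 + (yc X)^2 + c^2 \<and> \<alpha> * \<beta> = c^2 * (xc X)^2 \<and> \<beta> < c^2"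
      using axis2_opposite_le[OF assms X(2)] crossing_roots(1,2)[OF X(2)] assms unfolding X(3)
      by (intro exI[of _ "axis2_opposite j i"]) auto
  qed
  show "\<exists>C. hyperbola_or_limit F1 F2 C \<and> P_set v m \<subseteq> C" if "even m"
  proof (rule covered_by_hyperbola_or_limit[of _ \<alpha>])
    fix X assume "X \<in> P_set v m"
    then obtain i j where X: "i - j = m" "X \<in> crossing (side_line v j) (side_line v i)" "axis2_same j i = \<alpha>"
      using \<alpha> by blast
    have "even (j - i)" using that X(1) by auto
    then show "\<exists>\<beta>. \<alpha> + \<beta> = (xc X)^2 + (yc X)^2 + c^2 \<and> \<alpha> * \<beta> = c^2 * (xc X)^2 \<and> (\<alpha> < c^2 \<or> c^2 < \<beta>)"
      using axis2_same_le[OF assms X(2)] crossing_roots(1,2)[OF X(2)] assms unfolding X(3)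
      by (intro exI[of _ "axis2_opposite j i"]) auto
  qed (rule c_pos_if_hyperbolic[OF assms])
qed

text \<open>The parities of \<open>i + j\<close> and \<open>i - j\<close> agree, but \<alpha> is now
  the root with one line reversed, so the types are exchanged compared with
  \<open>P_set\<close>.\<close>

lemma Q_set_hyperbolic:
  assumes "A < c^2"
  shows "even m \<Longrightarrow> \<exists>C. ellipse_or_limit F1 F2 C \<and> Q_set v m \<subseteq> C"
    and "odd m \<Longrightarrow> \<exists>C. hyperbola_or_limit F1 F2 C \<and> Q_set v m \<subseteq> C"
proof -
  obtain \<alpha> where \<alpha>: "\<forall>X\<in>Q_set v m.
      \<exists>i j. i + j = m \<and> X \<in> crossing (side_line v i) (side_line v j) \<and> axis2_opposite i j = \<alpha>"
    using Q_set_roots[of m] by blast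
  show "\<exists>C. ellipse_or_limit F1 F2 C \<and> Q_set v m \<subseteq> C" if "even m"
  proof (rule covered_by_ellipse_or_limit[of _ \<alpha>])
    fix X assume "X \<in> Q_set v m"
    then obtain i j where X: "i + j = m" "X \<in> crossing (side_line v i) (side_line v j)" "axis2_opposite i j = \<alpha>"
      using \<alpha> by blast
    have "even (i - j)" using that X(1) by auto
    then show "\<exists>\<beta>. \<alpha> + \<beta> = (xc X)^2 + (yc X)^2 + c^2 \<and> \<alpha> * \<beta> = c^2 * (xc X)^2 \<and> \<beta> < c^2"
      using axis2_same_le[OF assms X(2)] crossing_roots(1,2)[OF X(2)] assms unfolding X(3)
      by (intro exI[of _ "axis2_same i j"]) (auto simp: algebra_simps)
  qed
  show "\<exists>C. hyperbola_or_limit F1 F2 C \<and> Q_set v m \<subseteq> C" if "odd m"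
  proof (rule covered_by_hyperbola_or_limit[of _ \<alpha>])
    fix X assume "X \<in> Q_set v m"
    then obtain i j where X: "i + j = m" "X \<in> crossing (side_line v i) (side_line v j)" "axis2_opposite i j = \<alpha>"
      using \<alpha> by blast
    have "odd (i - j)" using that X(1) by auto
    then show "\<exists>\<beta>. \<alpha> + \<beta> = (xc X)^2 + (yc X)^2 + c^2 \<and> \<alpha> * \<beta> = c^2 * (xc X)^2 \<and> (\<alpha> < c^2 \<or> c^2 < \<beta>)"
      using axis2_opposite_le[OF assms X(2)] crossing_roots(1,2)[OF X(2)] assms unfolding X(3)
      by (intro exI[of _ "axis2_same i j"]) (auto simp: algebra_simps)
  qed (rule c_pos_if_hyperbolic[OF assms])
qed

text \<open>If \<open>A = c\<^sup>2\<close>, then every line passes through a focus.\<close>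

lemma covered_if_focal:
  assumes A: "A = c^2"
    and S: "\<And>X. X \<in> S \<Longrightarrow> \<exists>\<beta> i j. \<alpha> + \<beta> = (xc X)^2 + (yc X)^2 + c^2 \<and> \<alpha> * \<beta> = c^2 * (xc X)^2
      \<and> X \<in> crossing (side_line v i) (side_line v j)"
  shows "\<exists>C. conic_or_limit F1 F2 C \<and> S \<subseteq> C"
proof -
  have c: "0 < c" if "S \<noteq> {}"
  proof (rule ccontr)
    \<comment> \<open>For coincident foci \<open>A = 0\<close>, so all lines are parallel and none
      cross.\<close>
    assume "\<not> 0 < c"
    then have "A = 0" using A c_nonneg by simp
    moreover obtain X i j where "X \<in> crossing (side_line v i) (side_line v j)"
      using S \<open>S \<noteq> {}\<close> by blast
    ultimately show False using crossing_side_lines(3) degenerate_parallel by blast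
  qed
  consider "c^2 < \<alpha>" | "\<alpha> < c^2" | "\<alpha> = c^2" by linarith
  then show ?thesis
  proof cases
    case 1
    then have "\<exists>C. confocal_ellipse F1 F2 C \<and> S \<subseteq> C"
      using S by (intro covered_by_ellipse[of S \<alpha>]) blast
    then show ?thesis unfolding conic_or_limit_def ellipse_or_limit_def by blast
  next
    case 2
    then have "\<exists>C. hyperbola_or_limit F1 F2 C \<and> S \<subseteq> C"
      using S c by (intro covered_by_hyperbola_or_limit[of S \<alpha>]) blast+
    then show ?thesis unfolding conic_or_limit_def by blast
  next
    case 3
    have "S \<subseteq> closed_segment F1 F2"
    proof
      fix X assume "X \<in> S"
      then obtain \<beta> i j where X: "c^2 + \<beta> = (xc X)^2 + (yc X)^2 + c^2" "c^2 * \<beta> = c^2 * (xc X)^2"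
        "X \<in> crossing (side_line v i) (side_line v j)"
        using S 3 by blast
      have "0 < c" using c \<open>X \<in> S\<close> by blast
      then have y: "yc X = 0" using double_root_on_axis[OF X(1,2)] by simp
      \<comment> \<open>At least one of the two crossing lines is not the focal axis. Since
        \<open>r^2 = c^2 * p^2\<close> for it, it meets the axis at a focus.\<close>
      have "\<exists>l. p l \<noteq> 0 \<and> p l * xc X = r l"
        using crossing_side_lines[OF X(3)] y by (cases "p i = 0") auto
      then obtain l where l: "p l \<noteq> 0" "p l * xc X = r l" by blast
      have "(p l)^2 = 1 - (q l)^2" "(r l)^2 = c^2 - c^2 * (q l)^2"
        using lines_on_curve[of l] A by (simp_all add: on_curve_def)
      then have "(p l * xc X)^2 = (p l)^2 * c^2"
        unfolding l(2) by algebra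
      then have "(p l)^2 * (xc X)^2 = (p l)^2 * c^2" by (simp add: power_mult_distrib)
      then have "(xc X)^2 = c^2" using l(1) by simp
      then show "X \<in> closed_segment F1 F2" using y by (intro mem_focal_segment) simp_all
    qed
    then show ?thesis
      unfolding conic_or_limit_def ellipse_or_limit_def limit_ellipse_def by blast
  qed
qed

lemma P_set_conic: "\<exists>C. conic_or_limit F1 F2 C \<and> P_set v m \<subseteq> C"
proof -
  consider "c^2 < A" | "A < c^2" | "A = c^2" by linarith
  then show ?thesis
  proof cases
    case 1
    then show ?thesis using P_set_elliptic unfolding conic_or_limit_def ellipse_or_limit_def by blast
  next
    case 2
    then show ?thesis using P_set_hyperbolic[of m] unfolding conic_or_limit_def by blast
  next
    case 3
    obtain \<alpha> where "\<forall>X\<in>P_set v m.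
        \<exists>i j. i - j = m \<and> X \<in> crossing (side_line v j) (side_line v i) \<and> axis2_same j i = \<alpha>"
      using P_set_roots[of m] by blast
    then show ?thesis
      using crossing_roots(1,2) by (intro covered_if_focal[OF 3, of _ \<alpha>]) metis
  qed
qed

lemma Q_set_conic: "\<exists>C. conic_or_limit F1 F2 C \<and> Q_set v m \<subseteq> C"
proof -
  consider "c^2 < A" | "A < c^2" | "A = c^2" by linarith
  then show ?thesis
  proof cases
    case 1
    then show ?thesis using Q_set_elliptic unfolding conic_or_limit_def by blast
  next
    case 2
    then show ?thesis using Q_set_hyperbolic[of m] unfolding conic_or_limit_def by blast
  next
    case 3
    obtain \<alpha> where "\<forall>X\<in>Q_set v m.
        \<exists>i j. i + j = m \<and> X \<in> crossing (side_line v i) (side_line v j) \<and> axis2_opposite i j = \<alpha>"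
      using Q_set_roots[of m] by blast
    then show ?thesis
      using crossing_roots(1,2) by (intro covered_if_focal[OF 3, of _ \<alpha>]) (metis add.commute mult.commute)
  qed
qed

section \<open>Recovering \<open>A\<close> from the caustic\<close>

lemma elliptic_caustic_A:
  assumes "elliptic_caustic F1 F2 v"
  shows "c^2 < A"
proof -
  obtain a where "dist F1 F2 < 2 * a" and "tangent_to_ellipse F1 F2 a (side_line v 0)"
    using assms unfolding elliptic_caustic_def by blast
  then obtain X where a: "c < a" and X: "X \<in> ellipse F1 F2 a"
    and line: "{Y. (Y - X) \<bullet> ellipse_normal F1 F2 X = 0} = {Y. p 0 * xc Y + q 0 * yc Y = r 0}"
    unfolding tangent_to_ellipse_def side_line_eq dist_foci by auto
  have pos: "0 < a^2" "c^2 < a^2" using a c_nonneg by (simp_all add: power_strict_mono)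
  obtain \<kappa> where \<kappa>: "\<kappa> > 0" "ellipse_normal F1 F2 X \<bullet> e1 = \<kappa> * (xc X / a^2)"
      "ellipse_normal F1 F2 X \<bullet> e2 = \<kappa> * (yc X / (a^2 - c^2))"
    using ellipse_equation(2)[OF X a] by blast
  have "(r 0)^2 = a^2 * (p 0)^2 + (a^2 - c^2) * (q 0)^2"
    by (rule tangency_condition[OF line \<kappa>(2,3)]) (use pos \<kappa>(1) ellipse_equation(1)[OF X a] in auto)
  \<comment> \<open>Tangency of a single line already determines the caustic.\<close>
  then have "A = a^2" using lines_on_curve[of 0] unfolding on_curve_def by (simp add: algebra_simps)
  then show ?thesis using pos by simp
qed

lemma hyperbolic_caustic_A:
  assumes "hyperbolic_caustic F1 F2 v"
  shows "A < c^2"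
proof -
  obtain d where d: "0 < d" "d < c" and tangent: "tangent_to_hyperbola F1 F2 d (side_line v 0)"
    using assms unfolding hyperbolic_caustic_def dist_foci by auto
  have curve: "(r 0)^2 = A - c^2 * (q 0)^2" using lines_on_curve[of 0] by (simp add: on_curve_def)
  have less: "d^2 < c^2" using d by (simp add: power_strict_mono)
  from tangent consider
      X where "X \<in> hyperbola F1 F2 d" "{Y. (Y - X) \<bullet> hyperbola_normal F1 F2 X = 0} = side_line v 0"
    | "asymptote F1 F2 d (side_line v 0)"
    unfolding tangent_to_hyperbola_def by blast
  then have "A = d^2"
  proof cases
    case 1
    obtain \<kappa> where \<kappa>: "\<kappa> \<noteq> 0" "hyperbola_normal F1 F2 X \<bullet> e1 = \<kappa> * (xc X / d^2)"
        "hyperbola_normal F1 F2 X \<bullet> e2 = \<kappa> * (yc X / (d^2 - c^2))"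
      using hyperbola_equation(2)[OF 1(1) d] by blast
    have "(r 0)^2 = d^2 * (p 0)^2 + (d^2 - c^2) * (q 0)^2"
      by (rule tangency_condition[OF 1(2)[unfolded side_line_eq] \<kappa>(2,3,1)])
        (use d less hyperbola_equation(1)[OF 1(1) d] in auto)
    then show ?thesis using lines_on_curve[of 0] unfolding on_curve_def by (simp add: algebra_simps)
  next
    case 2
    then obtain u where u: "u \<noteq> 0" "\<bar>u \<bullet> (F2 - F1)\<bar> = 2 * d * norm u"
      and line: "side_line v 0 = affine hull {midpoint F1 F2, midpoint F1 F2 + u}"
      unfolding asymptote_def by blast
    define u1 u2 where "u1 = u \<bullet> e1" and "u2 = u \<bullet> e2"
    have "{midpoint F1 F2, midpoint F1 F2 + u} \<subseteq> side_line v 0"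
      unfolding line by (rule hull_subset)
    \<comment> \<open>An asymptote passes through the centre, and its direction cosine
      \<open>q\<close> along the focal axis is \<open>d / c\<close> up to sign; so
      \<open>A = c^2 * q^2 = d^2\<close>.\<close>
    then have r: "r 0 = 0" and pq: "p 0 * u1 + q 0 * u2 = 0"
      by (auto simp: side_line_eq coords_add xc_def[of "midpoint F1 F2"] yc_def[of "midpoint F1 F2"] u1_def u2_def)
    have nu: "(norm u)^2 = u1^2 + u2^2" by (simp add: norm_frame u1_def u2_def)
    have "\<bar>2 * c * u1\<bar> = \<bar>2 * d * norm u\<bar>" using u(2) d(1) by (simp add: foci u1_def)
    then have "(2 * c * u1)^2 = (2 * d * norm u)^2" by (metis power2_abs)
    then have "c^2 * u1^2 = d^2 * (u1^2 + u2^2)" by (simp add: power_mult_distrib nu)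
    moreover have "(q 0)^2 * (u1^2 + u2^2) = u1^2"
      using pq unit_normal[of 0] by algebra
    ultimately have "(c^2 * (q 0)^2) * (u1^2 + u2^2) = d^2 * (u1^2 + u2^2)"
      by (simp add: mult.assoc)
    then have "c^2 * (q 0)^2 = d^2" using u(1) nu[symmetric] by simp
    then show ?thesis using curve r by simp
  qed
  then show ?thesis using less by simp
qed

end

theorem theorem18:
  fixes F1 F2 :: plane and s :: real and v :: "int \<Rightarrow> plane"
  assumes "dist F1 F2 < 2 * s"
    and "billiard_trajectory F1 F2 s v"
  shows "(\<forall>k. (\<exists>C. conic_or_limit F1 F2 C \<and> P_set v k \<subseteq> C) \<and>
              (\<exists>C. conic_or_limit F1 F2 C \<and> Q_set v k \<subseteq> C)) \<and>
         (elliptic_caustic F1 F2 v \<longrightarrow>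
           (\<forall>k. (\<exists>C. confocal_ellipse F1 F2 C \<and> P_set v k \<subseteq> C) \<and>
                (\<exists>C. hyperbola_or_limit F1 F2 C \<and> Q_set v k \<subseteq> C))) \<and>
         (hyperbolic_caustic F1 F2 v \<longrightarrow>
           (\<forall>k. (odd k \<longrightarrow> (\<exists>C. ellipse_or_limit F1 F2 C \<and> P_set v k \<subseteq> C)) \<and>
                (even k \<longrightarrow> (\<exists>C. hyperbola_or_limit F1 F2 C \<and> P_set v k \<subseteq> C)) \<and>
                (even k \<longrightarrow> (\<exists>C. ellipse_or_limit F1 F2 C \<and> Q_set v k \<subseteq> C)) \<and>
                (odd k \<longrightarrow> (\<exists>C. hyperbola_or_limit F1 F2 C \<and> Q_set v k \<subseteq> C))))"
proof -
  obtain e1 e2 where "focal_frame F1 F2 e1 e2 (dist F1 F2 / 2)"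
    using ex_focal_frame by blast
  then interpret focal_frame F1 F2 e1 e2 "dist F1 F2 / 2" .
  interpret billiard_frame F1 F2 e1 e2 "dist F1 F2 / 2" s v
    by unfold_locales (use assms in simp_all)
  have "\<forall>k. (\<exists>C. conic_or_limit F1 F2 C \<and> P_set v k \<subseteq> C) \<and>
            (\<exists>C. conic_or_limit F1 F2 C \<and> Q_set v k \<subseteq> C)"
    using P_set_conic Q_set_conic by blast
  moreover note P_set_elliptic[OF elliptic_caustic_A] Q_set_elliptic[OF elliptic_caustic_A]
    P_set_hyperbolic[OF hyperbolic_caustic_A] Q_set_hyperbolic[OF hyperbolic_caustic_A]
  ultimately show ?thesis by blast
qed

end
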